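(* Let $\lambda,\mu,\lambda',\mu'$ be partitions with $\mu\subseteq\lambda$, $\mu'\subseteq\lambda'$, and for integers $n\ge0$ let $Q(n)=\sum_\nu c(n\lambda+\lambda';n\mu+\mu',\nu)$. Suppose the skew diagram $\lambda/\mu$ is a partition or a rotated partition. Then there exists an $m$ with $Q(n)=Q(m)$ for all $n\geq m$. Furthermore, suppose $\lambda=(\alpha_1^{a_1},\alpha_2,\alpha_3,\ldots,\alpha_k)$ (i.e. $\alpha_1$ repeated $a_1\ge1$ times followed by $\alpha_2\ge\alpha_3\ge\dots\ge\alpha_k$) with $\alpha_k\neq 0$, $\mu=(\alpha_1^{a_1-1})$, and $\lambda'/\mu'$ is a basic skew diagram. Then the smallest $m$ such that $Q(n)=Q(m)$ for all $n\ge m$ is \[ m=\biggl\lceil \max_{\substack{1\leq j \leq k\\ \alpha_j>\alpha_{j+1}}} \Bigl( \frac{\lambda'_1- \lambda'_{a_j}+ \lambda'_{a_j+1}+\mu'_{a_1}-\mu'_{a_1-1}}{\alpha_j-\alpha_{j+1}} \Bigr) \biggr\rceil,\] where $a_j=a_1-1+j$, $\alpha_{k+1}=0$, and for $a_1=1$ one sets $\mu'_0=\lambda'_1$; and for this $m$, \[ Q(m)>Q(m-1)>\cdots>Q(0). \] Moreover, in the general case (i.e. only assuming that $\lambda/\mu$ is a partition or a rotated partition), if $m$ is chosen as the smallest integer with $Q(n)=Q(m)$ for all $n\ge m$, then again $Q(m)>Q(m-1)>\cdots>Q(0)$.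
   Context: $c(\alpha;\beta,\gamma)$ denotes the Littlewood–Richardson coefficient (number of semistandard tableaux of shape $\alpha/\beta$ and content $\gamma$ with lattice reverse row word; equivalently the coefficient of $s_\alpha$ in $s_\beta s_\gamma$). For a partition $\alpha$ and integer $n\ge0$, $n\alpha$ has parts $n\alpha_i$; $\alpha+\beta$ has parts $\alpha_i+\beta_i$; parts beyond the length are $0$. The skew diagram $\lambda/\mu$ is the set of boxes of the Young diagram of $\lambda$ not in that of $\mu$. A skew diagram is called a partition (resp. a rotated partition) if, after deleting all empty rows and empty columns and translating, its set of boxes is the Young diagram of a partition (resp. the $180^\circ$ rotation of the Young diagram of a partition). A skew diagram $\lambda'/\mu'$ is basic if $\mu'_i<\lambda'_i$ and $\mu'_i\le\lambda'_{i+1}$ for each $1\le i\le l(\lambda')$ (i.e. it has no empty rows or columns). $\lceil x\rceil$ is the smallest integer $\ge x$.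
   Formalization: The formula for the smallest m is read as the maximum of 0 and the stated ceiling, since the ceiling can be negative (λ=λ'=(1), μ=μ'=∅ gives −1, where Q(−1) is undefined and the smallest m is 0). *)

theory Defs
  imports Complex_Main
begin

text \<open>
  A partition is the function \<open>i \<mapsto> \<nu>\<^sub>i\<close> giving its parts. Parts are numbered from \<open>1\<close>; the value
  at \<open>0\<close> is fixed to \<open>0\<close> so that each partition has exactly one representation. Rows, columns and
  tableau entries are numbered from \<open>1\<close> as well.
\<close>

definition is_partition :: "(nat \<Rightarrow> nat) \<Rightarrow> bool" where
  "is_partition \<nu> \<longleftrightarrow>
     \<nu> 0 = 0 \<and> (\<forall>i\<ge>1. \<nu> (i + 1) \<le> \<nu> i) \<and> finite {i. \<nu> i \<noteq> 0}"

definition partition_of_list :: "nat list \<Rightarrow> nat \<Rightarrow> nat" where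
  "partition_of_list xs i = (if 1 \<le> i \<and> i \<le> length xs then xs ! (i - 1) else 0)"

definition part_length :: "(nat \<Rightarrow> nat) \<Rightarrow> nat" where
  "part_length \<nu> = card {i. \<nu> i \<noteq> 0}"

definition part_contained :: "(nat \<Rightarrow> nat) \<Rightarrow> (nat \<Rightarrow> nat) \<Rightarrow> bool" where
  "part_contained mu lam \<longleftrightarrow> (\<forall>i. mu i \<le> lam i)"

definition part_scale :: "nat \<Rightarrow> (nat \<Rightarrow> nat) \<Rightarrow> nat \<Rightarrow> nat" where
  "part_scale n \<nu> = (\<lambda>i. n * \<nu> i)"

definition part_add :: "(nat \<Rightarrow> nat) \<Rightarrow> (nat \<Rightarrow> nat) \<Rightarrow> nat \<Rightarrow> nat" where
  "part_add \<nu> \<nu>' = (\<lambda>i. \<nu> i + \<nu>' i)"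

definition young_diagram :: "(nat \<Rightarrow> nat) \<Rightarrow> (nat \<times> nat) set" where
  "young_diagram lam = {(i, j). 1 \<le> i \<and> 1 \<le> j \<and> j \<le> lam i}"

definition skew_diagram :: "(nat \<Rightarrow> nat) \<Rightarrow> (nat \<Rightarrow> nat) \<Rightarrow> (nat \<times> nat) set" where
  "skew_diagram lam mu = young_diagram lam - young_diagram mu"

text \<open>
  Deleting the empty rows and columns moves a box to the position given by the rank of its row
  among the nonempty rows and of its column among the nonempty columns. The result occupies an
  initial segment of rows and of columns, so no further translation is needed.
\<close>

definition delete_empty :: "(nat \<times> nat) set \<Rightarrow> (nat \<times> nat) set" where
  "delete_empty D =
     (\<lambda>(i, j). (card {i' \<in> fst ` D. i' \<le> i}, card {j' \<in> snd ` D. j' \<le> j})) ` D"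

definition diagram_is_partition :: "(nat \<times> nat) set \<Rightarrow> bool" where
  "diagram_is_partition D \<longleftrightarrow>
     (\<exists>\<nu>. is_partition \<nu> \<and> delete_empty D = young_diagram \<nu>)"

definition diagram_is_rotated_partition :: "(nat \<times> nat) set \<Rightarrow> bool" where
  "diagram_is_rotated_partition D \<longleftrightarrow>
     (\<exists>\<nu> r s. is_partition \<nu> \<and> young_diagram \<nu> \<subseteq> {..r} \<times> {..s} \<and>
        delete_empty D = (\<lambda>(i, j). (r - i, s - j)) ` young_diagram \<nu>)"

definition basic_skew :: "(nat \<Rightarrow> nat) \<Rightarrow> (nat \<Rightarrow> nat) \<Rightarrow> bool" where
  "basic_skew lam mu \<longleftrightarrow> (\<forall>i \<in> {1..part_length lam}. mu i < lam i \<and> mu i \<le> lam (i + 1))"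

text \<open>
  Tableaux are total functions that vanish outside their shape, so that distinct functions are
  distinct tableaux.
\<close>

definition semistandard :: "(nat \<times> nat) set \<Rightarrow> (nat \<Rightarrow> nat \<Rightarrow> nat) \<Rightarrow> bool" where
  "semistandard D T \<longleftrightarrow>
     (\<forall>i j. (i, j) \<in> D \<longrightarrow> 1 \<le> T i j) \<and>
     (\<forall>i j. (i, j) \<notin> D \<longrightarrow> T i j = 0) \<and>
     (\<forall>i j j'. (i, j) \<in> D \<and> (i, j') \<in> D \<and> j < j' \<longrightarrow> T i j \<le> T i j') \<and>
     (\<forall>i i' j. (i, j) \<in> D \<and> (i', j) \<in> D \<and> i < i' \<longrightarrow> T i j < T i' j)"

definition has_content :: "(nat \<times> nat) set \<Rightarrow> (nat \<Rightarrow> nat \<Rightarrow> nat) \<Rightarrow> (nat \<Rightarrow> nat) \<Rightarrow> bool" where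
  "has_content D T \<gamma> \<longleftrightarrow> (\<forall>k\<ge>1. card {(i, j) \<in> D. T i j = k} = \<gamma> k)"

definition reverse_row_word ::
  "(nat \<Rightarrow> nat) \<Rightarrow> (nat \<Rightarrow> nat) \<Rightarrow> (nat \<Rightarrow> nat \<Rightarrow> nat) \<Rightarrow> nat list" where
  "reverse_row_word lam mu T =
     concat (map (\<lambda>i. map (T i) (rev [mu i + 1..<lam i + 1])) [1..<part_length lam + 1])"

definition lattice_word :: "nat list \<Rightarrow> bool" where
  "lattice_word w \<longleftrightarrow>
     (\<forall>p. \<forall>k\<ge>1. count_list (take p w) (k + 1) \<le> count_list (take p w) k)"

definition LR_tableaux ::
  "(nat \<Rightarrow> nat) \<Rightarrow> (nat \<Rightarrow> nat) \<Rightarrow> (nat \<Rightarrow> nat) \<Rightarrow> (nat \<Rightarrow> nat \<Rightarrow> nat) set" where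
  "LR_tableaux \<alpha> \<beta> \<gamma> =
     {T. semistandard (skew_diagram \<alpha> \<beta>) T \<and> has_content (skew_diagram \<alpha> \<beta>) T \<gamma> \<and>
         lattice_word (reverse_row_word \<alpha> \<beta> T)}"

definition lr_coeff :: "(nat \<Rightarrow> nat) \<Rightarrow> (nat \<Rightarrow> nat) \<Rightarrow> (nat \<Rightarrow> nat) \<Rightarrow> nat" where
  "lr_coeff \<alpha> \<beta> \<gamma> = (if part_contained \<beta> \<alpha> then card (LR_tableaux \<alpha> \<beta> \<gamma>) else 0)"

text \<open>
  The sum over all partitions \<open>\<nu>\<close> has finite support and is written as the sum over its support
  (see \<open>finite_lr_support\<close> below).
\<close>

definition Q_sum ::
  "(nat \<Rightarrow> nat) \<Rightarrow> (nat \<Rightarrow> nat) \<Rightarrow> (nat \<Rightarrow> nat) \<Rightarrow> (nat \<Rightarrow> nat) \<Rightarrow> nat \<Rightarrow> nat" where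
  "Q_sum lam mu lam' mu' n =
     (let \<alpha> = part_add (part_scale n lam) lam'; \<beta> = part_add (part_scale n mu) mu'
      in \<Sum>\<nu> | is_partition \<nu> \<and> lr_coeff \<alpha> \<beta> \<nu> \<noteq> 0. lr_coeff \<alpha> \<beta> \<nu>)"

lemma finite_young_diagram:
  assumes "is_partition lam"
  shows "finite (young_diagram lam)"
proof -
  have "young_diagram lam = (SIGMA i:{i. 1 \<le> i \<and> lam i \<noteq> 0}. {1..lam i})"
    by (auto simp: young_diagram_def)
  moreover have "finite {i. 1 \<le> i \<and> lam i \<noteq> 0}"
    using assms by (auto simp: is_partition_def intro: rev_finite_subset)
  ultimately show ?thesis by simp
qed

lemma finite_lr_support:
  assumes "is_partition \<alpha>"
  shows "finite {\<nu>. is_partition \<nu> \<and> lr_coeff \<alpha> \<beta> \<nu> \<noteq> 0}"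
proof -
  define D where "D = skew_diagram \<alpha> \<beta>"
  define N where "N = card D"
  have finD: "finite D"
    using finite_young_diagram[OF assms] by (simp add: D_def skew_diagram_def)
  have mono: "\<nu> j \<le> \<nu> i" if "is_partition \<nu>" "1 \<le> i" "i \<le> j" for \<nu> :: "nat \<Rightarrow> nat" and i j
    using that(3,2)
  proof (induction j rule: dec_induct)
    case (step n)
    then have "\<nu> (n + 1) \<le> \<nu> n" using that(1) by (simp add: is_partition_def)
    with step show ?case by simp
  qed simp
  have bounds: "(\<forall>k. \<nu> k \<le> N) \<and> (\<forall>k>N. \<nu> k = 0)"
    if \<nu>: "is_partition \<nu>" and nz: "lr_coeff \<alpha> \<beta> \<nu> \<noteq> 0" for \<nu>
  proof -
    from nz have "card (LR_tableaux \<alpha> \<beta> \<nu>) \<noteq> 0"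
      by (auto simp: lr_coeff_def split: if_splits)
    then have "LR_tableaux \<alpha> \<beta> \<nu> \<noteq> {}" by force
    then obtain T where T: "has_content D T \<nu>"
      by (auto simp: LR_tableaux_def D_def)
    define B where "B k = {(i, j) \<in> D. T i j = k}" for k
    have cardB: "card (B k) = \<nu> k" if "1 \<le> k" for k
      using T that by (simp add: has_content_def B_def)
    have subB: "B k \<subseteq> D" for k by (auto simp: B_def)
    have "\<nu> k \<le> N" for k
    proof (cases "1 \<le> k")
      case True
      then show ?thesis
        using cardB card_mono[OF finD subB] by (metis N_def)
    next
      case False
      then have "k = 0" by simp
      with \<nu> show ?thesis by (simp add: is_partition_def)
    qed
    moreover have "\<nu> k = 0" if "k > N" for k
    proof (rule ccontr)
      assume "\<nu> k \<noteq> 0"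
      then have ge: "1 \<le> \<nu> l" if "l \<in> {1..k}" for l
        using mono[OF \<nu>, of l k] that by auto
      have "k = (\<Sum>l\<in>{1..k}. 1)" by simp
      also have "\<dots> \<le> (\<Sum>l\<in>{1..k}. card (B l))"
        by (intro sum_mono) (use ge cardB in auto)
      also have "\<dots> = card (\<Union>l\<in>{1..k}. B l)"
        by (rule card_UN_disjoint[symmetric])
          (use finD subB in \<open>auto simp: B_def intro: rev_finite_subset\<close>)
      also have "\<dots> \<le> N"
        unfolding N_def by (rule card_mono[OF finD]) (use subB in blast)
      finally show False using that by simp
    qed
    ultimately show ?thesis by blast
  qed
  have "{\<nu>. is_partition \<nu> \<and> lr_coeff \<alpha> \<beta> \<nu> \<noteq> 0}
        \<subseteq> {\<nu>. \<forall>k. (k \<in> {..N} \<longrightarrow> \<nu> k \<in> {..N}) \<and> (k \<notin> {..N} \<longrightarrow> \<nu> k = 0)}"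
    using bounds by auto
  then show ?thesis
    by (rule finite_subset) (rule finite_set_of_finite_funs; simp)
qed

definition stable_from :: "(nat \<Rightarrow> nat) \<Rightarrow> nat \<Rightarrow> bool" where
  "stable_from Q m \<longleftrightarrow> (\<forall>n\<ge>m. Q n = Q m)"

definition least_stable :: "(nat \<Rightarrow> nat) \<Rightarrow> nat \<Rightarrow> bool" where
  "least_stable Q m \<longleftrightarrow> stable_from Q m \<and> (\<forall>m'. stable_from Q m' \<longrightarrow> m \<le> m')"

text \<open>
  Here \<open>a = a\<^sub>1\<close>, so that \<open>a\<^sub>j = a - 1 + j\<close>. The maximum can be negative (for example
  \<open>lam = lam' = (1)\<close>, \<open>mu = mu' = ()\<close>), in which case the smallest \<open>m \<ge> 0\<close> is \<open>0\<close>;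
  the conversion \<open>nat\<close> sends negative integers to \<open>0\<close>.
\<close>

definition stable_bound ::
  "(nat \<Rightarrow> nat) \<Rightarrow> (nat \<Rightarrow> nat) \<Rightarrow> nat \<Rightarrow> nat \<Rightarrow> (nat \<Rightarrow> nat) \<Rightarrow> nat" where
  "stable_bound lam' mu' a k \<alpha> =
     (let aj = (\<lambda>j. a - 1 + j);
          mu'_prev = (if a = 1 then lam' 1 else mu' (a - 1))
      in nat \<lceil>Max {(real (lam' 1) - real (lam' (aj j)) + real (lam' (aj j + 1))
                      + real (mu' a) - real mu'_prev) / (real (\<alpha> j) - real (\<alpha> (j + 1)))
                     | j. 1 \<le> j \<and> j \<le> k \<and> \<alpha> j > \<alpha> (j + 1)}\<rceil>)"

end

(*
  A Littlewood-Richardson tableau of shape a/b is recorded by the numbers m i k of entries k in row i;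
  the tableau conditions become linear inequalities in m, so arrays of the shapes lam/mu and lam'/mu' add
  up to arrays of the sum of the shapes. Adding a fixed array t of shape lam/mu embeds the arrays at stage n
  into those at stage n + 1.

  Growth propagates downwards: if m at stage n + 2 does not arise from stage n + 1, then m - t violates an
  inequality. Take the first row with a violation. The admissible choices for one row form a polymatroid
  base polytope, and every admissible prefix of rows extends to an admissible array; hence there is an
  array at stage n + 1 for which one of the inequalities violated by m - t is an equality. As m satisfies
  that inequality, t satisfies it strictly, so the new array does not arise from stage n. Thus Q increases
  strictly until it becomes constant.

  If the nonempty rows of lam/mu all start, or all end, in the same column, then column strictness and the
  lattice condition confine every array at stage n to a bounded neighbourhood of n times a fixed array, so
  Q is bounded. In the special family the lattice condition between the entries j and j + 1 is the last
  one to be relaxed, and its largest possible violation is computed exactly.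
*)

theory Submission
  imports Defs
begin

text \<open>A lattice point may violate a linear inequality that is an equality at no lattice point
  of the polytope; this could block the descent from stage n + 2 to stage n + 1. Two features remove
  the obstacle. The conditions on a row involve only that row and the rows above it, so an equality
  arranged in row \<open>Suc i\<close> survives whatever is put below. And within one row the
  conditions are nonnegativity, bounds on single counts and bounds on initial sums, so moving one
  unit at a time leads from an integral choice towards the inadmissible one and stops at an integral
  choice that is tight at a violated bound.

  Growth is a comparison of cardinalities, so it does not depend on the choice of the fixed array
  \<open>t\<close>: the general argument takes a superstandard one, the special family takes
  \<open>block\<close>, whose slacks can be estimated. The sharpness of the index is not tested at
  stage n itself, because the construction of the extremal array asks for a large stage; assumed
  stability carries that array back to stage n.\<close>

section \<open>Arrays of entry counts\<close>

text \<open>Number of entries \<open>k\<close> in rows 1 to \<open>i\<close>: a column sum of the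
  array, unrelated to the columns of the tableau. Values are integers because differences of arrays
  may become negative.\<close>

primrec colcount :: "(nat \<Rightarrow> nat \<Rightarrow> int) \<Rightarrow> nat \<Rightarrow> nat \<Rightarrow> int" where
  "colcount m 0 k = 0"
| "colcount m (Suc i) k = colcount m i k + m (Suc i) k"

text \<open>The column in which the entries up to \<open>k\<close> of row \<open>i\<close> end, the
  inner shape included. Column strictness and the length of the row are both conditions on these
  numbers.\<close>

primrec rowend :: "(nat \<Rightarrow> int) \<Rightarrow> (nat \<Rightarrow> nat \<Rightarrow> int) \<Rightarrow> nat \<Rightarrow> nat \<Rightarrow> int" where
  "rowend b m i 0 = b i"
| "rowend b m i (Suc k) = rowend b m i k + m i (Suc k)"

text \<open>The conditions on row \<open>Suc i\<close>, relative to the rows above it.\<close>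

definition lr_row :: "(nat \<Rightarrow> int) \<Rightarrow> (nat \<Rightarrow> int) \<Rightarrow> (nat \<Rightarrow> nat \<Rightarrow> int) \<Rightarrow> nat \<Rightarrow> bool" where
  "lr_row a b m i \<longleftrightarrow>
     (\<forall>k. 0 \<le> m (Suc i) k) \<and> rowend b m (Suc i) (Suc i) = a (Suc i) \<and>
     (\<forall>k. colcount m (Suc i) (Suc (Suc k)) \<le> colcount m i (Suc k)) \<and>
     (0 < i \<longrightarrow> (\<forall>k. rowend b m (Suc i) (Suc k) \<le> rowend b m i k))"

text \<open>The lattice condition forces the entries of row \<open>i\<close> to lie between 1 and
  \<open>i\<close>. Fixing all other values to 0 makes each tableau correspond to exactly one
  array.\<close>

definition lower_tri :: "(nat \<Rightarrow> nat \<Rightarrow> int) \<Rightarrow> bool" where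
  "lower_tri m \<longleftrightarrow> (\<forall>i k. k = 0 \<or> i < k \<longrightarrow> m i k = 0)"

definition lr_arrays :: "(nat \<Rightarrow> int) \<Rightarrow> (nat \<Rightarrow> int) \<Rightarrow> (nat \<Rightarrow> nat \<Rightarrow> int) set" where
  "lr_arrays a b = {m. lower_tri m \<and> (\<forall>i. lr_row a b m i)}"

definition skew_shape :: "(nat \<Rightarrow> int) \<Rightarrow> (nat \<Rightarrow> int) \<Rightarrow> bool" where
  "skew_shape a b \<longleftrightarrow> (\<forall>i\<ge>1. b i \<le> a i \<and> a (Suc i) \<le> a i \<and> b (Suc i) \<le> b i)"

lemma colcount_cong: "(\<And>r. r \<le> i \<Longrightarrow> m r = m' r) \<Longrightarrow> colcount m i k = colcount m' i k"
  by (induction i) auto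

lemma rowend_cong: "m i = m' i \<Longrightarrow> rowend b m i k = rowend b m' i k"
  by (induction k) auto

lemma lr_row_cong:
  assumes "\<And>r. r \<le> Suc i \<Longrightarrow> m r = m' r"
  shows "lr_row a b m i = lr_row a b m' i"
proof -
  have "colcount m (Suc i) k = colcount m' (Suc i) k" "colcount m i k = colcount m' i k"
    "rowend b m (Suc i) k = rowend b m' (Suc i) k" "rowend b m i k = rowend b m' i k" for k
    using assms by (auto intro!: colcount_cong rowend_cong simp del: colcount.simps)
  then show ?thesis using assms[of "Suc i"] by (simp add: lr_row_def del: colcount.simps rowend.simps)
qed

lemma colcount_add: "colcount (\<lambda>i k. m i k + t i k) i k = colcount m i k + colcount t i k"
  by (induction i) auto

lemma colcount_diff: "colcount (\<lambda>i k. m i k - t i k) i k = colcount m i k - colcount t i k"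
  by (induction i) auto

lemma rowend_add:
  "rowend (\<lambda>i. b i + d i) (\<lambda>i k. m i k + t i k) i k = rowend b m i k + rowend d t i k"
  by (induction k) auto

lemma rowend_diff:
  "rowend (\<lambda>i. b i - d i) (\<lambda>i k. m i k - t i k) i k = rowend b m i k - rowend d t i k"
  by (induction k) auto

lemma lr_arrays_add:
  assumes "m \<in> lr_arrays a b" "t \<in> lr_arrays c d"
  shows "(\<lambda>i k. m i k + t i k) \<in> lr_arrays (\<lambda>i. a i + c i) (\<lambda>i. b i + d i)"
  using assms
  by (auto simp: lr_arrays_def lower_tri_def lr_row_def colcount_add rowend_add
      intro!: add_mono add_nonneg_nonneg simp del: colcount.simps rowend.simps)

lemma lower_tri_rowend_const:
  assumes "lower_tri m" "i \<le> k" shows "rowend b m i k = rowend b m i i"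
  using assms(2,1) by (induction k rule: dec_induct) (auto simp: lower_tri_def)

lemma lower_tri_colcount_zero: "lower_tri m \<Longrightarrow> i < k \<Longrightarrow> colcount m i k = 0"
  by (induction i) (auto simp: lower_tri_def)

section \<open>Consequences of the conditions for a single array\<close>

context
  fixes a b m
  assumes m: "m \<in> lr_arrays a b"
begin

lemma lr_nonneg: "0 \<le> m i k"
proof (cases i)
  case 0
  then show ?thesis using m by (cases k) (auto simp: lr_arrays_def lower_tri_def)
next
  case (Suc i')
  then show ?thesis using m unfolding lr_arrays_def lr_row_def by blast
qed

lemma lr_tri: "k = 0 \<or> i < k \<Longrightarrow> m i k = 0"
  using m by (auto simp: lr_arrays_def lower_tri_def)

lemma lr_lattice: "colcount m (Suc i) (Suc (Suc k)) \<le> colcount m i (Suc k)"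
  using m unfolding lr_arrays_def lr_row_def by blast

lemma lr_column: "0 < i \<Longrightarrow> rowend b m (Suc i) (Suc k) \<le> rowend b m i k"
  using m unfolding lr_arrays_def lr_row_def by blast

lemma lr_rowend_full: assumes "0 < i" "i \<le> k" shows "rowend b m i k = a i"
proof -
  obtain i' where "i = Suc i'" using assms by (cases i) auto
  then have "rowend b m i i = a i" using m unfolding lr_arrays_def lr_row_def by blast
  then show ?thesis using lower_tri_rowend_const[OF _ assms(2)] m by (auto simp: lr_arrays_def)
qed

lemma lr_rowend_mono: "k \<le> l \<Longrightarrow> rowend b m i k \<le> rowend b m i l"
  by (induction l rule: dec_induct) (auto intro: add_increasing2 lr_nonneg)

lemma lr_rowend_le: "0 < i \<Longrightarrow> rowend b m i k \<le> a i"
  using lr_rowend_mono[of k "max k i" i] lr_rowend_full[of i "max k i"] by simp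

lemma lr_rowend_ge: "b i \<le> rowend b m i k"
  using lr_rowend_mono[of 0 k i] by simp

lemma lr_column_chain: "0 < i \<Longrightarrow> rowend b m (i + d) (k + d) \<le> rowend b m i k"
  by (induction d) (auto intro: order_trans[OF lr_column] simp del: rowend.simps)

lemma lr_lattice_chain: "0 < k \<Longrightarrow> colcount m (i + d) (k + d) \<le> colcount m i k"
proof (induction d)
  case (Suc d)
  then obtain k' where "k = Suc k'" by (cases k) auto
  then show ?case using lr_lattice[of "i + d" "k' + d"] Suc by simp
qed simp

lemma lr_colcount_nonneg: "0 \<le> colcount m i k"
  by (induction i) (auto intro: add_nonneg_nonneg lr_nonneg)

lemma lr_colcount_mono: "i \<le> j \<Longrightarrow> colcount m i k \<le> colcount m j k"
  by (induction j rule: dec_induct) (auto intro: add_increasing2 lr_nonneg)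

lemma lr_colcount_partition: "colcount m i (Suc (Suc k)) \<le> colcount m i (Suc k)"
  using lr_lattice[of i k] lr_nonneg[of "Suc i" "Suc (Suc k)"] by simp

text \<open>Each entry \<open>Suc l\<close> of row \<open>Suc i\<close> consumes part of the excess
  of \<open>l\<close> over \<open>Suc l\<close> in the rows above. Summed over all \<open>l\<close>
  from \<open>k\<close> on, the excesses telescope, which limits the number of entries above
  \<open>k\<close> in the row.\<close>

lemma lr_tail:
  assumes "0 < k" shows "a (Suc i) - rowend b m (Suc i) k \<le> colcount m i k"
proof -
  have step: "m (Suc i) (Suc l) \<le> colcount m i l - colcount m i (Suc l)" if l: "0 < l" for l
  proof -
    obtain l' where "l = Suc l'" using l by (cases l) auto
    then show ?thesis using lr_lattice[of i l'] by simp
  qed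
  have "rowend b m (Suc i) K - rowend b m (Suc i) k \<le> colcount m i k - colcount m i K" if "k \<le> K" for K
    using that
  proof (induction K rule: dec_induct)
    case (step K)
    then show ?case using \<open>\<And>l. 0 < l \<Longrightarrow> m (Suc i) (Suc l) \<le> _ l\<close>[of K] assms by simp
  qed simp
  from this[of "max k (Suc i)"] show ?thesis
    using lr_rowend_full[of "Suc i" "max k (Suc i)"] lr_colcount_nonneg[of i "max k (Suc i)"] by simp
qed

lemma lr_tail_row:
  "a (Suc i) - rowend b m (Suc i) k \<le> colcount m (Suc i) (Suc k)"
  using lr_tail[of "Suc k" i] by simp

text \<open>The lattice condition, summed over all values above \<open>k\<close>. The left side
  counts the boxes of \<open>Suc i\<close> rows with entry above \<open>Suc k\<close>, the right
  side those of \<open>i\<close> rows with entry above \<open>k\<close>.\<close>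

lemma lr_large_entries:
  "(\<Sum>r<Suc i. a (Suc r) - rowend b m (Suc r) (Suc k)) \<le> (\<Sum>r<i. a (Suc r) - rowend b m (Suc r) k)"
proof -
  have re: "rowend b m r (k + d) - rowend b m r k = (\<Sum>l<d. m r (Suc (k + l)))" for r k d
    by (induction d) auto
  have cc: "colcount m i k = (\<Sum>r<i. m (Suc r) k)" for i k
    by (induction i) auto
  \<comment> \<open>Row \<open>r\<close> has entries at most \<open>r\<close>, so with
    \<open>i \<le> k + d\<close> the \<open>d\<close> values after \<open>k\<close> are all that
    occur, and the count by rows becomes a count by values.\<close>
  have eq: "(\<Sum>r<i. a (Suc r) - rowend b m (Suc r) k) = (\<Sum>l<d. colcount m i (Suc (k + l)))"
    if "i \<le> k + d" for i k d
  proof -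
    have "(\<Sum>r<i. a (Suc r) - rowend b m (Suc r) k)
        = (\<Sum>r<i. \<Sum>l<d. m (Suc r) (Suc (k + l)))"
    proof (rule sum.cong[OF refl])
      fix r assume "r \<in> {..<i}"
      then have "a (Suc r) = rowend b m (Suc r) (k + d)"
        using that lr_rowend_full[of "Suc r" "k + d"] by simp
      then show "a (Suc r) - rowend b m (Suc r) k = (\<Sum>l<d. m (Suc r) (Suc (k + l)))"
        using re by metis
    qed
    also have "\<dots> = (\<Sum>l<d. colcount m i (Suc (k + l)))"
      unfolding cc by (rule sum.swap)
    finally show ?thesis .
  qed
  have "(\<Sum>r<Suc i. a (Suc r) - rowend b m (Suc r) (Suc k)) = (\<Sum>l<Suc i. colcount m (Suc i) (Suc (Suc k + l)))"
    by (rule eq) simp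
  also have "\<dots> \<le> (\<Sum>l<Suc i. colcount m i (Suc (k + l)))"
    by (rule sum_mono) (use lr_lattice in simp)
  also have "\<dots> = (\<Sum>r<i. a (Suc r) - rowend b m (Suc r) k)"
    by (rule eq[symmetric]) simp
  finally show ?thesis .
qed

lemma lr_large_entries_chain:
  "(\<Sum>r<i + d. a (Suc r) - rowend b m (Suc r) (k + d)) \<le> (\<Sum>r<i. a (Suc r) - rowend b m (Suc r) k)"
proof (induction d)
  case (Suc d)
  then show ?case using lr_large_entries[where i = "i + d" and k = "k + d"] by simp
qed simp

end

section \<open>Superstandard continuation of a prefix of rows\<close>

text \<open>The next row of a superstandard extension: a box below an entry \<open>l\<close> receives \<open>Suc l\<close>, and a
  box with nothing above it receives \<open>1\<close>.\<close>

definition super_row :: "(nat \<Rightarrow> int) \<Rightarrow> (nat \<Rightarrow> int) \<Rightarrow> nat \<Rightarrow> (nat \<Rightarrow> int) \<Rightarrow> nat \<Rightarrow> int" where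
  "super_row a b j r k =
     (if j = 0 then (if k = 1 then a 1 - b 1 else 0)
      else (case k of 0 \<Rightarrow> 0 | Suc k' \<Rightarrow> min (a (Suc j)) (rowend b (\<lambda>_. r) j k') -
        (case k' of 0 \<Rightarrow> b (Suc j) | Suc k'' \<Rightarrow> min (a (Suc j)) (rowend b (\<lambda>_. r) j k''))))"

text \<open>The case distinction in \<open>super_row\<close> amounts to a truncated shift: every run
  of equal entries of row \<open>j\<close> is repeated one value higher and cut off at the length of
  the new row.\<close>

lemma rowend_super_row:
  assumes "m (Suc j) = super_row a b j (m j)" "0 < j"
  shows "rowend b m (Suc j) (Suc k) = min (a (Suc j)) (rowend b m j k)"
proof -
  have re: "rowend b (\<lambda>_. m j) j k = rowend b m j k" for k by (rule rowend_cong) simp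
  show ?thesis
  proof (induction k)
    case 0
    then show ?case using assms by (simp add: super_row_def)
  next
    case (Suc k)
    have "m (Suc j) (Suc (Suc k)) = min (a (Suc j)) (rowend b m j (Suc k)) - min (a (Suc j)) (rowend b m j k)"
      using assms by (simp add: super_row_def re del: rowend.simps)
    then show ?case using Suc rowend.simps(2)[of b m "Suc j" "Suc k"] by linarith
  qed
qed

text \<open>The new row has at most as many entries \<open>Suc (Suc k)\<close> as row
  \<open>j\<close> has entries \<open>Suc k\<close>, so the lattice condition of row
  \<open>j\<close> passes to the next row. The column condition holds because row ends are shifted
  by one value.\<close>

lemma lr_row_super_row:
  assumes sk: "skew_shape a b" and tri: "\<And>k. k = 0 \<or> j < k \<Longrightarrow> m j k = 0"
    and prev: "0 < j \<Longrightarrow> lr_row a b m (j - 1)"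
    and new: "m (Suc j) = super_row a b j (m j)"
  shows "lr_row a b m j \<and> (\<forall>k. k = 0 \<or> Suc j < k \<longrightarrow> m (Suc j) k = 0) \<and>
    (0 < j \<longrightarrow> m (Suc j) 1 = min (a (Suc j)) (b j) - b (Suc j))"
proof (cases "j = 0")
  case True
  have "b 1 \<le> a 1" using sk by (simp add: skew_shape_def)
  then show ?thesis using True new by (auto simp: lr_row_def super_row_def)
next
  case False
  then obtain i where j: "j = Suc i" by (cases j) auto
  have P: "lr_row a b m i" using prev j by simp
  have re: "rowend b (\<lambda>_. m j) j k = rowend b m j k" for k by (rule rowend_cong) simp
  have new1: "m (Suc j) (Suc 0) = min (a (Suc j)) (b j) - b (Suc j)"
    using new False by (simp add: super_row_def)
  have newS: "m (Suc j) (Suc (Suc k)) = min (a (Suc j)) (rowend b m j (Suc k)) - min (a (Suc j)) (rowend b m j k)" for k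
    using new False by (simp add: super_row_def re del: rowend.simps)
  have new0: "m (Suc j) 0 = 0" using new False by (simp add: super_row_def)
  have aj: "rowend b m j j = a j" using P by (simp add: lr_row_def j)
  have full: "rowend b m j k = a j" if "j \<le> k" for k
    using that by (induction k rule: dec_induct) (use aj tri in auto)
  have pos: "0 \<le> m j k" for k using P by (auto simp: lr_row_def j)
  have sk': "b (Suc j) \<le> b j" "a (Suc j) \<le> a j" "b (Suc j) \<le> a (Suc j)"
    using sk False by (auto simp: skew_shape_def)
  have le: "m (Suc j) (Suc (Suc k)) \<le> m j (Suc k) \<and> 0 \<le> m (Suc j) (Suc (Suc k))" for k
    using newS[of k] pos[of "Suc k"] by auto
  have nn: "0 \<le> m (Suc j) k" for k
  proof (cases k)
    case (Suc k')
    then show ?thesis using le new1 sk' by (cases k') auto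
  qed (simp add: new0)
  have "rowend b m (Suc j) (Suc j) = a (Suc j)"
    using rowend_super_row[of m j a b j] new False full[of j] sk' by (simp del: rowend.simps)
  moreover have "colcount m (Suc j) (Suc (Suc k)) \<le> colcount m j (Suc k)" for k
  proof -
    have "colcount m j (Suc (Suc k)) \<le> colcount m i (Suc k)"
      using P unfolding j lr_row_def by blast
    then show ?thesis using le[of k] by (simp add: j)
  qed
  moreover have "rowend b m (Suc j) (Suc k) \<le> rowend b m j k" for k
    using rowend_super_row[of m j a b k] new False by (simp del: rowend.simps)
  moreover have "m (Suc j) k = 0" if "Suc j < k" for k
  proof -
    define k' where "k' = k - 2"
    have k: "k = Suc (Suc k')" "j \<le> k'" using that by (auto simp: k'_def)
    show ?thesis unfolding k newS using full[of k'] full[of "Suc k'"] k(2) by (simp del: rowend.simps)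
  qed
  ultimately show ?thesis using nn new0 new1 by (simp add: lr_row_def del: rowend.simps colcount.simps)
qed

text \<open>Rows up to \<open>n\<close> are kept and each later row is the superstandard one below
  its predecessor, so no admissible prefix is a dead end. The number of entries 1 is recorded for
  the extremal construction.\<close>

lemma lr_prefix_extend:
  assumes sk: "skew_shape a b" and tri: "lower_tri m" and pre: "\<And>i. i < n \<Longrightarrow> lr_row a b m i"
  obtains m' where "m' \<in> lr_arrays a b" "\<And>i. i \<le> n \<Longrightarrow> m' i = m i"
    "\<And>i. n \<le> i \<Longrightarrow> 0 < i \<Longrightarrow> m' (Suc i) 1 = min (a (Suc i)) (b i) - b (Suc i)"
proof -
  define m' where "m' = rec_nat (m 0) (\<lambda>j r. if Suc j \<le> n then m (Suc j) else super_row a b j r)"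
  have m'0: "m' 0 = m 0" by (simp add: m'_def)
  have m'S: "m' (Suc j) = (if Suc j \<le> n then m (Suc j) else super_row a b j (m' j))" for j
    by (simp add: m'_def)
  have agree: "m' i = m i" if "i \<le> n" for i
    using that m'0 m'S by (cases i) auto
  have main: "lr_row a b m' j \<and> (\<forall>k. k = 0 \<or> Suc j < k \<longrightarrow> m' (Suc j) k = 0) \<and>
     (n \<le> j \<longrightarrow> 0 < j \<longrightarrow> m' (Suc j) 1 = min (a (Suc j)) (b j) - b (Suc j))" for j
  proof (induction j)
    case 0
    show ?case
    proof (cases "0 < n")
      case True
      then show ?thesis using pre[of 0] agree tri lr_row_cong[of 0 m' m a b]
        by (auto simp: lower_tri_def)
    next
      case False
      then show ?thesis using lr_row_super_row[OF sk, of 0 m'] tri m'0 m'S[of 0]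
        by (auto simp: lower_tri_def)
    qed
  next
    case (Suc j)
    show ?case
    proof (cases "Suc j < n")
      case True
      then show ?thesis using pre[of "Suc j"] agree tri lr_row_cong[of "Suc j" m' m a b]
        by (auto simp: lower_tri_def)
    next
      case False
      then show ?thesis using lr_row_super_row[OF sk, of "Suc j" m'] Suc m'S[of "Suc j"]
        by auto
    qed
  qed
  have "m' 0 k = 0" for k using m'0 tri by (cases k) (auto simp: lower_tri_def)
  then have "lower_tri m'"
    unfolding lower_tri_def using main by (metis not0_implies_Suc)
  with main agree show ?thesis by (intro that[of m']) (auto simp: lr_arrays_def)
qed

text \<open>Under \<open>b r \<le> a (Suc r)\<close> the length of a row never truncates its entries
  1, and their numbers telescope. The value reached is the upper bound of
  \<open>lr_ones_le\<close>.\<close>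

lemma lr_superstandard:
  assumes "skew_shape a b"
  obtains m where "m \<in> lr_arrays a b"
    "\<And>i. (\<And>r. 1 \<le> r \<Longrightarrow> r < i \<Longrightarrow> b r \<le> a (Suc r)) \<Longrightarrow> 0 < i \<Longrightarrow> colcount m i 1 = a 1 - b i"
proof -
  obtain m where m: "m \<in> lr_arrays a b"
    and one: "\<And>i. 0 < i \<Longrightarrow> m (Suc i) 1 = min (a (Suc i)) (b i) - b (Suc i)"
    using lr_prefix_extend[OF assms, of "\<lambda>_ _. 0" 0] by (auto simp: lower_tri_def)
  have "colcount m i 1 = a 1 - b i" if "\<And>r. 1 \<le> r \<Longrightarrow> r < i \<Longrightarrow> b r \<le> a (Suc r)" "0 < i" for i
    using that(2,1)
  proof (induction i)
    case (Suc i)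
    show ?case
    proof (cases "i = 0")
      case True
      then show ?thesis using lr_rowend_full[OF m, of 1 1] by simp
    next
      case False
      then show ?thesis using Suc one[of i] by simp
    qed
  qed simp
  with m show ?thesis using that by blast
qed

section \<open>Tight bounds by unit exchange, and growth from stage to stage\<close>

section \<open>Propagation of growth\<close>

text \<open>The choices for one row once the rows above are fixed: \<open>u\<close> is the lattice
  bound on single counts, \<open>c\<close> the column bound on initial sums. The sets
  \<open>A\<close> and \<open>B\<close> are needed since the value 1 has no lattice bound and the
  top row has no column bound.\<close>

definition row_feasible ::
  "nat \<Rightarrow> nat set \<Rightarrow> (nat \<Rightarrow> int) \<Rightarrow> nat set \<Rightarrow> (nat \<Rightarrow> int) \<Rightarrow> int \<Rightarrow> (nat \<Rightarrow> int) \<Rightarrow> bool" where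
  "row_feasible K A u B c N v \<longleftrightarrow>
     (\<forall>k. 0 \<le> v k) \<and> (\<forall>k. k \<notin> {1..K} \<longrightarrow> v k = 0) \<and> (\<forall>k\<in>A. v k \<le> u k) \<and>
     (\<forall>k\<in>B. sum v {1..k} \<le> c k) \<and> sum v {1..K} = N"

lemma sum_unit_exchange:
  fixes v :: "nat \<Rightarrow> int"
  shows "(\<Sum>q=1..p. v q + of_bool (q = k) - of_bool (q = l)) =
    sum v {1..p} + of_bool (k \<in> {1..p}) - of_bool (l \<in> {1..p})"
  by (simp add: sum.distrib sum_subtractf of_bool_def sum.delta)

text \<open>As long as no bound violated by \<open>w\<close> is tight at \<open>v\<close>, one unit
  can be moved from a value where \<open>v\<close> exceeds \<open>w\<close> to one where it falls
  short, which lowers the l1 distance by 2. The distance never becomes 0 because \<open>w\<close> is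
  infeasible, so the process must end at a tight violated bound.\<close>

lemma row_exchange_tight:
  assumes "row_feasible K A u B c N v"
    and w: "sum w {1..K} = N" "\<And>k. k \<notin> {1..K} \<Longrightarrow> w k = 0" "\<not> row_feasible K A u B c N w"
    and AB: "A \<subseteq> {1..K}" "B \<subseteq> {1..K}"
  shows "\<exists>v. row_feasible K A u B c N v \<and>
    ((\<exists>k. v k = 0 \<and> w k < 0) \<or> (\<exists>k\<in>A. v k = u k \<and> u k < w k) \<or>
     (\<exists>k\<in>B. sum v {1..k} = c k \<and> c k < sum w {1..k}))"
  using assms(1)
proof (induction "nat (\<Sum>q=1..K. \<bar>v q - w q\<bar>)" arbitrary: v rule: less_induct)
  case less
  note v = less.prems
  let ?tight = "\<lambda>v. (\<exists>k. v k = 0 \<and> w k < 0) \<or> (\<exists>k\<in>A. v k = u k \<and> u k < w k) \<or>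
     (\<exists>k\<in>B. sum v {1..k} = c k \<and> c k < sum w {1..k})"
  show ?case
  proof (cases "?tight v")
    case True
    with v show ?thesis by blast
  next
    case False
    \<comment> \<open>The move raises initial sums only at positions \<open>p\<close> with
      \<open>k \<le> p < l\<close>, so only these need room. The bound 0 at \<open>l\<close> and the
      bound \<open>u k\<close> cannot be attained by \<open>v\<close>: \<open>w\<close> would
      violate them.\<close>
    have exch: ?thesis if k: "v k < w k" and l: "w l < v l"
      and room: "\<And>p. k \<le> p \<Longrightarrow> p < l \<Longrightarrow> p \<in> B \<Longrightarrow> sum v {1..p} < c p" for k l
    proof -
      define v' where "v' q = v q + of_bool (q = k) - of_bool (q = l)" for q
      have ne: "k \<noteq> l" using k l by auto
      have kl: "k \<in> {1..K}" "l \<in> {1..K}"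
        using k l v w(2) by (force simp: row_feasible_def)+
      have ps: "sum v' {1..p} = sum v {1..p} + of_bool (k \<in> {1..p}) - of_bool (l \<in> {1..p})" for p
        unfolding v'_def by (rule sum_unit_exchange)
      have lpos: "0 < v l"
      proof -
        have "0 \<le> v l" using v by (simp add: row_feasible_def)
        moreover have "v l \<noteq> 0" using False l by auto
        ultimately show ?thesis by simp
      qed
      have kup: "v k < u k" if "k \<in> A"
      proof -
        have "v k \<le> u k" using v that by (simp add: row_feasible_def)
        moreover have "v k \<noteq> u k" using False k that by auto
        ultimately show ?thesis by simp
      qed
      have f': "row_feasible K A u B c N v'"
        unfolding row_feasible_def
      proof (intro conjI allI ballI impI)
        show "0 \<le> v' q" for q using v lpos by (auto simp: v'_def row_feasible_def)
        show "v' q = 0" if "q \<notin> {1..K}" for q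
          using v kl that by (auto simp: v'_def row_feasible_def)
        show "v' q \<le> u q" if "q \<in> A" for q
          using v kup that ne by (cases "q = k"; cases "q = l") (force simp: v'_def row_feasible_def)+
        show "sum v' {1..p} \<le> c p" if "p \<in> B" for p
        proof -
          have "sum v {1..p} \<le> c p" using v that by (simp add: row_feasible_def)
          then show ?thesis using room[of p] that kl unfolding ps by (auto simp: of_bool_def)
        qed
        show "sum v' {1..K} = N" using v kl unfolding ps by (simp add: row_feasible_def)
      qed
      have d: "\<bar>v' q - w q\<bar> = \<bar>v q - w q\<bar> - of_bool (q = k) - of_bool (q = l)" for q
        using k l ne by (auto simp: v'_def)
      have "(\<Sum>q=1..K. \<bar>v' q - w q\<bar>) = (\<Sum>q=1..K. \<bar>v q - w q\<bar>) - 2"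
        unfolding d using kl by (simp add: sum_subtractf of_bool_def sum.delta)
      moreover have "0 \<le> (\<Sum>q=1..K. \<bar>v' q - w q\<bar>)" by (simp add: sum_nonneg)
      ultimately have "nat (\<Sum>q=1..K. \<bar>v' q - w q\<bar>) < nat (\<Sum>q=1..K. \<bar>v q - w q\<bar>)" by linarith
      from less.hyps[OF this f'] show ?thesis .
    qed
    have eqsum: "(\<Sum>q=1..K. w q - v q) = 0"
      using w(1) v by (simp add: sum_subtractf row_feasible_def)
    have "v \<noteq> w" using v w(3) by blast
    then obtain q where q: "v q \<noteq> w q" by blast
    then have qK: "q \<in> {1..K}" using v w(2) by (force simp: row_feasible_def)
    have "\<exists>l\<in>{1..K}. w l < v l"
    proof (rule ccontr)
      assume "\<not> ?thesis"
      then have "\<forall>l\<in>{1..K}. 0 \<le> w l - v l" by force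
      then have "\<forall>l\<in>{1..K}. w l - v l = 0" using eqsum sum_nonneg_eq_0_iff[of "{1..K}" "\<lambda>q. w q - v q"] by auto
      then show False using q qK by auto
    qed
    then have ex: "\<exists>l. l \<in> {1..K} \<and> w l < v l" by blast
    \<comment> \<open>The least choice gives \<open>v \<le> w\<close> before \<open>l\<close>. For
      \<open>k < l\<close> the initial sums of \<open>v\<close> at \<open>p\<close> with
      \<open>k \<le> p < l\<close> then lie strictly below those of \<open>w\<close>, so a tight one
      would be a violated one. For \<open>l < k\<close> the move raises no initial sum.\<close>
    define l where "l = (LEAST l. l \<in> {1..K} \<and> w l < v l)"
    have l: "l \<in> {1..K}" "w l < v l" using LeastI_ex[OF ex] by (auto simp: l_def)
    have lmin: "v p \<le> w p" if "p < l" for p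
    proof (cases "p \<in> {1..K}")
      case True
      then show ?thesis using not_less_Least[of p "\<lambda>l. l \<in> {1..K} \<and> w l < v l"] that by (force simp: l_def)
    next
      case False
      then show ?thesis using v w(2) by (force simp: row_feasible_def)
    qed
    have "\<exists>k\<in>{1..K}. v k < w k"
    proof (rule ccontr)
      assume "\<not> ?thesis"
      then have "\<forall>l\<in>{1..K}. 0 \<le> v l - w l" by force
      moreover have "(\<Sum>q=1..K. v q - w q) = 0" using eqsum by (simp add: sum_subtractf)
      ultimately have "\<forall>l\<in>{1..K}. v l - w l = 0" using sum_nonneg_eq_0_iff[of "{1..K}" "\<lambda>q. v q - w q"] by auto
      then show False using q qK by auto
    qed
    then obtain k where k: "k \<in> {1..K}" "v k < w k" by blast
    show ?thesis
    proof (cases "l < k")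
      case True
      then show ?thesis by (intro exch[OF k(2) l(2)]) auto
    next
      case False
      show ?thesis
      proof (rule exch[OF k(2) l(2)])
        fix p assume p: "k \<le> p" "p < l" "p \<in> B"
        have "0 < (\<Sum>q=1..p. w q - v q)"
          by (rule sum_pos2[of _ k]) (use p k lmin in auto)
        then have "sum v {1..p} < sum w {1..p}" by (simp add: sum_subtractf)
        moreover have "sum v {1..p} \<le> c p" using v p by (simp add: row_feasible_def)
        moreover have "\<not> (sum v {1..p} = c p \<and> c p < sum w {1..p})" using \<open>\<not> ?tight v\<close> p by blast
        ultimately show "sum v {1..p} < c p" by linarith
      qed
    qed
  qed
qed

lemma rowend_sum: "rowend b m i k = b i + sum (m i) {1..k}"
  by (induction k) auto

text \<open>Finitely many bounds suffice: beyond the triangle the counts vanish and the row ends are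
  constant, so the remaining conditions hold by themselves.\<close>

lemma lr_row_iff_feasible:
  assumes tri: "lower_tri m"
  shows "lr_row a b m i \<longleftrightarrow> row_feasible (Suc i) {2..Suc i}
    (\<lambda>k. colcount m i (k - 1) - colcount m i k) (if i = 0 then {} else {1..Suc i})
    (\<lambda>k. rowend b m i (k - 1) - b (Suc i)) (a (Suc i) - b (Suc i)) (m (Suc i))" (is "_ \<longleftrightarrow> ?F")
proof
  assume L: "lr_row a b m i"
  show ?F
    unfolding row_feasible_def
  proof (intro conjI allI ballI impI)
    show "0 \<le> m (Suc i) k" for k using L by (auto simp: lr_row_def)
    show "m (Suc i) k = 0" if "k \<notin> {1..Suc i}" for k
      using that tri unfolding lower_tri_def by (cases k) auto
    show "m (Suc i) k \<le> colcount m i (k - 1) - colcount m i k" if "k \<in> {2..Suc i}" for k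
    proof -
      define k' where "k' = k - 2"
      have k: "k = Suc (Suc k')" using that by (auto simp: k'_def)
      have "colcount m (Suc i) (Suc (Suc k')) \<le> colcount m i (Suc k')" using L unfolding lr_row_def by blast
      then show ?thesis by (simp add: k)
    qed
    show "sum (m (Suc i)) {1..k} \<le> rowend b m i (k - 1) - b (Suc i)" if "k \<in> (if i = 0 then {} else {1..Suc i})" for k
    proof -
      have k: "i > 0" "k = Suc (k - 1)" using that by (auto split: if_splits)
      have "rowend b m (Suc i) (Suc (k - 1)) \<le> rowend b m i (k - 1)" using L k(1) unfolding lr_row_def by blast
      then show ?thesis using k(2) rowend_sum[of b m "Suc i" k] by (simp del: rowend.simps)
    qed
    show "sum (m (Suc i)) {1..Suc i} = a (Suc i) - b (Suc i)"
      using L rowend_sum[of b m "Suc i" "Suc i"] by (simp add: lr_row_def)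
  qed
next
  assume F: ?F
  have full: "rowend b m (Suc i) (Suc i) = a (Suc i)"
    using F rowend_sum[of b m "Suc i" "Suc i"] by (simp add: row_feasible_def)
  show "lr_row a b m i"
    unfolding lr_row_def
  proof (intro conjI allI impI)
    show "0 \<le> m (Suc i) k" for k using F by (simp add: row_feasible_def)
    show "rowend b m (Suc i) (Suc i) = a (Suc i)" by (rule full)
    show "colcount m (Suc i) (Suc (Suc k)) \<le> colcount m i (Suc k)" for k
    proof (cases "Suc (Suc k) \<in> {2..Suc i}")
      case True
      then have "m (Suc i) (Suc (Suc k)) \<le> colcount m i (Suc (Suc k) - 1) - colcount m i (Suc (Suc k))"
        using F unfolding row_feasible_def by blast
      then show ?thesis by simp
    next
      case False
      then show ?thesis using lower_tri_colcount_zero[OF tri, of "Suc i" "Suc (Suc k)"]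
          lower_tri_colcount_zero[OF tri, of i "Suc k"] by simp
    qed
    show "rowend b m (Suc i) (Suc k) \<le> rowend b m i k" if "0 < i" for k
    proof -
      have le: "rowend b m (Suc i) (Suc k) \<le> rowend b m i k" if "k \<le> i" for k
      proof -
        have "Suc k \<in> (if i = 0 then {} else {1..Suc i})" using that \<open>0 < i\<close> by simp
        then have "sum (m (Suc i)) {1..Suc k} \<le> rowend b m i (Suc k - 1) - b (Suc i)"
          using F unfolding row_feasible_def by blast
        then show ?thesis using rowend_sum[of b m "Suc i" "Suc k"] by (simp del: rowend.simps)
      qed
      show ?thesis
      proof (cases "k \<le> i")
        case False
        then show ?thesis using le[of i] lower_tri_rowend_const[OF tri, of "Suc i" "Suc k" b]
            lower_tri_rowend_const[OF tri, of i k b] by simp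
      qed (rule le)
    qed
  qed
qed

text \<open>The exchange is carried out in the first violated row. The rows above it are those of
  \<open>w\<close>, so both arrays face the same right-hand sides there, and the rows added below
  leave the equality untouched.\<close>

lemma lr_violated_constraint_tight:
  assumes sk: "skew_shape a b" and tri: "lower_tri w"
    and full: "\<And>i. rowend b w (Suc i) (Suc i) = a (Suc i)" and bad: "w \<notin> lr_arrays a b"
  obtains m where "m \<in> lr_arrays a b"
    "(\<exists>i k. m i k = 0 \<and> w i k < 0) \<or>
     (\<exists>i k. colcount m (Suc i) (Suc (Suc k)) = colcount m i (Suc k) \<and>
        colcount w i (Suc k) < colcount w (Suc i) (Suc (Suc k))) \<or>
     (\<exists>i k. 0 < i \<and> rowend b m (Suc i) (Suc k) = rowend b m i k \<and>
        rowend b w i k < rowend b w (Suc i) (Suc k))"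
proof -
  have "\<exists>i. \<not> lr_row a b w i" using bad tri by (auto simp: lr_arrays_def)
  define i where "i = (LEAST i. \<not> lr_row a b w i)"
  have i: "\<not> lr_row a b w i" unfolding i_def by (rule LeastI_ex) fact
  have pre: "lr_row a b w r" if "r < i" for r using that not_less_Least unfolding i_def by blast
  \<comment> \<open>Its row \<open>Suc i\<close> serves only as a feasible starting point for the
    exchange.\<close>
  obtain m0 where m0: "m0 \<in> lr_arrays a b" "\<And>r. r \<le> i \<Longrightarrow> m0 r = w r"
    by (rule lr_prefix_extend[OF sk tri pre]) (assumption, blast)
  define A where "A = {2..Suc i}"
  define B where "B = (if i = 0 then {} else {1..Suc i})"
  define u where "u k = colcount w i (k - 1) - colcount w i k" for k
  define c where "c k = rowend b w i (k - 1) - b (Suc i)" for k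
  define N where "N = a (Suc i) - b (Suc i)"
  let ?F = "row_feasible (Suc i) A u B c N"
  have iff: "lr_row a b m' i \<longleftrightarrow> ?F (m' (Suc i))" if "lower_tri m'" "\<And>r. r \<le> i \<Longrightarrow> m' r = w r" for m'
  proof -
    have "colcount m' i k = colcount w i k" "rowend b m' i k = rowend b w i k" for k
      using that(2) by (auto intro: colcount_cong rowend_cong)
    then show ?thesis using lr_row_iff_feasible[OF that(1), of a b i]
      unfolding A_def B_def u_def[abs_def] c_def[abs_def] N_def by simp
  qed
  have f1: "?F (m0 (Suc i))" using iff[of m0] m0 by (auto simp: lr_arrays_def)
  have f2: "sum (w (Suc i)) {1..Suc i} = N"
    using full[of i] rowend_sum[of b w "Suc i" "Suc i"] by (simp add: N_def del: rowend.simps)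
  have f3: "w (Suc i) k = 0" if "k \<notin> {1..Suc i}" for k
    using that tri unfolding lower_tri_def by (cases k) auto
  have f4: "\<not> ?F (w (Suc i))" using iff[of w] i tri by simp
  have f5: "A \<subseteq> {1..Suc i}" "B \<subseteq> {1..Suc i}" by (auto simp: A_def B_def)
  obtain v where v: "?F v" "(\<exists>k. v k = 0 \<and> w (Suc i) k < 0) \<or> (\<exists>k\<in>A. v k = u k \<and> u k < w (Suc i) k) \<or>
     (\<exists>k\<in>B. sum v {1..k} = c k \<and> c k < sum (w (Suc i)) {1..k})"
    using row_exchange_tight[OF f1 f2 f3 f4 f5] by auto
  define w' where "w' = w(Suc i := v)"
  have tri': "lower_tri w'"
    using tri v(1) by (auto simp: lower_tri_def w'_def row_feasible_def)
  have pre': "lr_row a b w' r" if "r < Suc i" for r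
  proof (cases "r = i")
    case True
    then show ?thesis using iff[OF tri'] v(1) by (simp add: w'_def)
  next
    case False
    then show ?thesis using pre[of r] that lr_row_cong[of r w' w a b] by (auto simp: w'_def)
  qed
  obtain m where m: "m \<in> lr_arrays a b" "\<And>r. r \<le> Suc i \<Longrightarrow> m r = w' r"
    by (rule lr_prefix_extend[OF sk tri' pre']) (assumption, blast)
  have row: "m (Suc i) = v" using m(2)[of "Suc i"] by (simp add: w'_def)
  have cc: "colcount m i k = colcount w i k" and re: "rowend b m i k = rowend b w i k" for k
    using m(2) by (auto intro!: colcount_cong rowend_cong simp: w'_def)
  from v(2) consider (1) k where "v k = 0" "w (Suc i) k < 0"
    | (2) k where "k \<in> A" "v k = u k" "u k < w (Suc i) k"
    | (3) k where "k \<in> B" "sum v {1..k} = c k" "c k < sum (w (Suc i)) {1..k}" by blast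
  then show ?thesis
  proof cases
    case 1
    then show ?thesis using that[OF m(1)] row by metis
  next
    case 2
    define k' where "k' = k - 2"
    have k: "k = Suc (Suc k')" using 2(1) by (auto simp: k'_def A_def)
    have "colcount m (Suc i) (Suc (Suc k')) = colcount m i (Suc k') \<and>
      colcount w i (Suc k') < colcount w (Suc i) (Suc (Suc k'))"
      using 2(2,3) by (simp add: k row cc u_def)
    then show ?thesis using that[OF m(1)] by blast
  next
    case 3
    then have i0: "0 < i" and k: "k = Suc (k - 1)" by (auto simp: B_def split: if_splits)
    have "rowend b m (Suc i) k = rowend b m i (k - 1) \<and> rowend b w i (k - 1) < rowend b w (Suc i) k"
      using 3(2,3) by (simp add: rowend_sum[of _ _ "Suc i"] row c_def re)
    then show ?thesis using that[OF m(1)] i0 k by metis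
  qed
qed

text \<open>A bound that is violated by \<open>m - t\<close> but satisfied by \<open>m\<close> holds
  strictly for \<open>t\<close>; being an equality for \<open>m'\<close>, it is violated by
  \<open>m' - t\<close>. None of the three kinds of bound mentions the outer shape, so
  \<open>a'\<close> may be anything.\<close>

lemma lr_growth_propagates:
  assumes sk: "skew_shape a b" and t: "t \<in> lr_arrays c d"
    and m: "m \<in> lr_arrays (\<lambda>i. a i + c i) (\<lambda>i. b i + d i)"
    and bad: "(\<lambda>i k. m i k - t i k) \<notin> lr_arrays a b"
  obtains m' where "m' \<in> lr_arrays a b" 
    "\<And>a' b'. (\<And>i. b i = b' i + d i) \<Longrightarrow> (\<lambda>i k. m' i k - t i k) \<notin> lr_arrays a' b'"
proof -
  define w where "w = (\<lambda>i k. m i k - t i k)"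
  have re: "rowend b w i k = rowend (\<lambda>i. b i + d i) m i k - rowend d t i k" for i k
    using rowend_diff[of "\<lambda>i. b i + d i" d m t i k] by (simp add: w_def)
  have cc: "colcount w i k = colcount m i k - colcount t i k" for i k
    unfolding w_def by (rule colcount_diff)
  have tri: "lower_tri w" using lr_tri[OF m] lr_tri[OF t] by (simp add: lower_tri_def w_def)
  have full: "rowend b w (Suc i) (Suc i) = a (Suc i)" for i
    using lr_rowend_full[OF m, of "Suc i" "Suc i"] lr_rowend_full[OF t, of "Suc i" "Suc i"] by (simp add: re del: rowend.simps)
  obtain m' where m': "m' \<in> lr_arrays a b"
    "(\<exists>i k. m' i k = 0 \<and> w i k < 0) \<or>
     (\<exists>i k. colcount m' (Suc i) (Suc (Suc k)) = colcount m' i (Suc k) \<and>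
        colcount w i (Suc k) < colcount w (Suc i) (Suc (Suc k))) \<or>
     (\<exists>i k. 0 < i \<and> rowend b m' (Suc i) (Suc k) = rowend b m' i k \<and>
        rowend b w i k < rowend b w (Suc i) (Suc k))"
    using lr_violated_constraint_tight[OF sk tri full] bad unfolding w_def by blast
  have "(\<lambda>i k. m' i k - t i k) \<notin> lr_arrays a' b'" if b': "\<And>i. b i = b' i + d i" for a' b'
  proof
    assume z: "(\<lambda>i k. m' i k - t i k) \<in> lr_arrays a' b'"
    have re': "rowend b' (\<lambda>i k. m' i k - t i k) i k = rowend b m' i k - rowend d t i k" for i k
      using rowend_diff[of b d m' t i k] b' by simp
    from m'(2) consider (1) i k where "m' i k = 0" "w i k < 0"
      | (2) i k where "colcount m' (Suc i) (Suc (Suc k)) = colcount m' i (Suc k)"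
          "colcount w i (Suc k) < colcount w (Suc i) (Suc (Suc k))"
      | (3) i k where "0 < i" "rowend b m' (Suc i) (Suc k) = rowend b m' i k"
          "rowend b w i k < rowend b w (Suc i) (Suc k)" by blast
    then show False
    proof cases
      case 1
      then show ?thesis using lr_nonneg[OF z, of i k] lr_nonneg[OF m, of i k] by (simp add: w_def)
    next
      case 2
      then show ?thesis using lr_lattice[OF z, of i k] lr_lattice[OF m, of i k]
        unfolding cc colcount_diff by linarith
    next
      case 3
      then show ?thesis using lr_column[OF z, of i k] lr_column[OF m, of i k]
        unfolding re re' by linarith
    qed
  qed
  with m'(1) show ?thesis by (rule that)
qed

section \<open>Littlewood-Richardson tableaux counted by arrays\<close>

section \<open>Tableaux and arrays\<close>

lemma is_partition_mono:
  assumes "is_partition \<nu>" "1 \<le> i" "i \<le> j" shows "\<nu> j \<le> \<nu> i"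
  using assms(3,2)
proof (induction j rule: dec_induct)
  case (step n)
  then have "\<nu> (n + 1) \<le> \<nu> n" using assms(1) by (simp add: is_partition_def)
  with step show ?case by simp
qed simp

lemma is_partition_zero_beyond_length:
  assumes "is_partition \<nu>" "part_length \<nu> < i" shows "\<nu> i = 0"
proof (rule ccontr)
  assume nz: "\<nu> i \<noteq> 0"
  have "{1..i} \<subseteq> {i. \<nu> i \<noteq> 0}"
    using is_partition_mono[OF assms(1), of _ i] nz by force
  then have "card {1..i} \<le> part_length \<nu>"
    using assms(1) unfolding part_length_def by (intro card_mono) (auto simp: is_partition_def)
  then show False using assms(2) by simp
qed

lemma finite_bounded_arrays:
  "finite {m :: nat \<Rightarrow> nat \<Rightarrow> int. \<forall>i k. (i \<le> L \<and> k \<le> L \<longrightarrow> \<bar>m i k\<bar> \<le> C) \<and> (\<not> (i \<le> L \<and> k \<le> L) \<longrightarrow> m i k = 0)}"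
proof -
  define F where "F = {f :: nat \<Rightarrow> int. \<forall>k. (k \<in> {..L} \<longrightarrow> f k \<in> {-C..C}) \<and> (k \<notin> {..L} \<longrightarrow> f k = 0)}"
  have "finite F" unfolding F_def by (rule finite_set_of_finite_funs) auto
  then have "finite {m. \<forall>i. (i \<in> {..L} \<longrightarrow> m i \<in> F) \<and> (i \<notin> {..L} \<longrightarrow> m i = (\<lambda>_. 0))}"
    by (intro finite_set_of_finite_funs) auto
  then show ?thesis
  proof (rule rev_finite_subset, intro subsetI CollectI allI)
    fix m :: "nat \<Rightarrow> nat \<Rightarrow> int" and i
    assume "m \<in> {m. \<forall>i k. (i \<le> L \<and> k \<le> L \<longrightarrow> \<bar>m i k\<bar> \<le> C) \<and> (\<not> (i \<le> L \<and> k \<le> L) \<longrightarrow> m i k = 0)}"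
    then have *: "(i \<le> L \<and> k \<le> L \<longrightarrow> \<bar>m i k\<bar> \<le> C) \<and> (\<not> (i \<le> L \<and> k \<le> L) \<longrightarrow> m i k = 0)" for k by blast
    have "m i k \<in> {-C..C}" if "i \<le> L" "k \<le> L" for k using *[of k] that by auto
    then show "(i \<in> {..L} \<longrightarrow> m i \<in> F) \<and> (i \<notin> {..L} \<longrightarrow> m i = (\<lambda>_. 0))"
      using * by (auto simp: F_def)
  qed
qed

lemma finite_lr_arrays:
  assumes "\<And>i. L < i \<Longrightarrow> a i = b i"
  shows "finite (lr_arrays a b)"
proof -
  define C where "C = (\<Sum>i\<le>L. \<bar>a i - b i\<bar>)"
  have "lr_arrays a b \<subseteq> {m. \<forall>i k. (i \<le> L \<and> k \<le> L \<longrightarrow> \<bar>m i k\<bar> \<le> C) \<and> (\<not> (i \<le> L \<and> k \<le> L) \<longrightarrow> m i k = 0)}"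
  proof (intro subsetI CollectI allI conjI impI)
    fix m i k assume m: "m \<in> lr_arrays a b"
    have le: "m i k \<le> a i - b i" if "0 < k" "k \<le> i"
    proof -
      define k' where "k' = k - 1"
      have "k = Suc k'" using that by (simp add: k'_def)
      then show ?thesis using lr_rowend_le[OF m, of i k] lr_rowend_ge[OF m, of i k'] that by simp
    qed
    show "\<bar>m i k\<bar> \<le> C" if "i \<le> L \<and> k \<le> L"
    proof (cases "0 < k \<and> k \<le> i")
      case True
      have "\<bar>a i - b i\<bar> \<le> C" unfolding C_def
        by (rule member_le_sum[where f = "\<lambda>i. \<bar>a i - b i\<bar>"]) (use that in auto)
      then show ?thesis using le True lr_nonneg[OF m, of i k] by linarith
    next
      case False
      then show ?thesis using lr_tri[OF m, of k i] by (auto simp: C_def sum_nonneg)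
    qed
    show "m i k = 0" if "\<not> (i \<le> L \<and> k \<le> L)"
    proof (cases "0 < k \<and> k \<le> i")
      case True
      then show ?thesis using le lr_nonneg[OF m, of i k] assms[of i] that by auto
    next
      case False
      then show ?thesis using lr_tri[OF m, of k i] by auto
    qed
  qed
  then show ?thesis using finite_bounded_arrays by (rule finite_subset)
qed

text \<open>The content is left free: summing the coefficients over all contents amounts to counting
  these tableaux.\<close>

definition lr_fillings :: "(nat \<Rightarrow> nat) \<Rightarrow> (nat \<Rightarrow> nat) \<Rightarrow> (nat \<Rightarrow> nat \<Rightarrow> nat) set" where
  "lr_fillings \<alpha> \<beta> = {T. semistandard (skew_diagram \<alpha> \<beta>) T \<and> lattice_word (reverse_row_word \<alpha> \<beta> T)}"

definition entry_counts :: "(nat \<Rightarrow> nat) \<Rightarrow> (nat \<Rightarrow> nat) \<Rightarrow> (nat \<Rightarrow> nat \<Rightarrow> nat) \<Rightarrow> nat \<Rightarrow> nat \<Rightarrow> int" where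
  "entry_counts \<alpha> \<beta> T i k = int (card {j \<in> {\<beta> i<..\<alpha> i}. T i j = k})"

text \<open>Applied to the boxes of a row with entry at most a given value, which form an initial
  segment of the row.\<close>

lemma interval_downset:
  fixes S :: "nat set"
  assumes "S \<subseteq> {p<..q}" "\<And>j j'. j' \<in> S \<Longrightarrow> p < j \<Longrightarrow> j \<le> j' \<Longrightarrow> j \<in> S"
  shows "S = {p<..p + card S}"
proof (cases "S = {}")
  case False
  have fin: "finite S" using assms(1) by (rule finite_subset) simp
  have "S = {p<..Max S}"
    using assms Max_in[OF fin False] Max_ge[OF fin] by (auto; blast)
  moreover from this have "card S = Max S - p" by (metis card_greaterThanAtMost)
  moreover have "p < Max S" using Max_in[OF fin False] assms(1) by auto
  ultimately show ?thesis by simp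
qed simp

lemma count_list_take_le: "count_list (take q xs) x \<le> count_list xs x"
proof -
  have "count_list xs x = count_list (take q xs) x + count_list (drop q xs) x"
    by (metis append_take_drop_id count_list_append)
  then show ?thesis by simp
qed

lemma count_list_map_rev_upt:
  "count_list (map f (rev [p + 1..<r + 1])) x = card {j \<in> {p<..r}. f j = x}"
proof (induction r)
  case (Suc r)
  show ?case
  proof (cases "p \<le> r")
    case True
    have "{j \<in> {p<..Suc r}. f j = x} = (if f (Suc r) = x then {Suc r} else {}) \<union> {j \<in> {p<..r}. f j = x}"
      using True by (auto simp: le_Suc_eq)
    moreover have "card ((if f (Suc r) = x then {Suc r} else {}) \<union> {j \<in> {p<..r}. f j = x}) =
       card (if f (Suc r) = x then {Suc r} else {}) + card {j \<in> {p<..r}. f j = x}"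
      by (rule card_Un_disjoint) auto
    ultimately show ?thesis using Suc True by simp
  qed auto
qed simp

lemma lattice_word_append:
  "lattice_word (xs @ ys) \<longleftrightarrow> lattice_word xs \<and>
     (\<forall>q. \<forall>k\<ge>1. count_list (xs @ take q ys) (k + 1) \<le> count_list (xs @ take q ys) k)"
  (is "?L \<longleftrightarrow> ?R")
proof
  assume L: ?L
  show ?R unfolding lattice_word_def
  proof (intro conjI allI impI)
    fix p k :: nat assume k: "1 \<le> k"
    show "count_list (take p xs) (k + 1) \<le> count_list (take p xs) k"
    proof -
      have "take (min p (length xs)) (xs @ ys) = take p xs" by (simp add: min_def)
      then show ?thesis using L k unfolding lattice_word_def by metis
    qed
    have "take (length xs + p) (xs @ ys) = xs @ take p ys" by simp
    then show "count_list (xs @ take p ys) (k + 1) \<le> count_list (xs @ take p ys) k"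
      using L k unfolding lattice_word_def by metis
  qed
next
  assume R: ?R
  show ?L unfolding lattice_word_def
  proof (intro allI impI)
    fix p k :: nat assume k: "1 \<le> k"
    show "count_list (take p (xs @ ys)) (k + 1) \<le> count_list (take p (xs @ ys)) k"
    proof (cases "p \<le> length xs")
      case True
      then show ?thesis using R k by (simp add: lattice_word_def)
    next
      case False
      then have "take p (xs @ ys) = xs @ take (p - length xs) ys" by simp
      then show ?thesis using R k by metis
    qed
  qed
qed

context
  fixes \<alpha> \<beta> :: "nat \<Rightarrow> nat"
  assumes \<alpha>: "is_partition \<alpha>" and \<beta>: "is_partition \<beta>" and \<beta>\<alpha>: "part_contained \<beta> \<alpha>"
begin

lemma skew_diagram_iff: "(i, j) \<in> skew_diagram \<alpha> \<beta> \<longleftrightarrow> j \<in> {\<beta> i<..\<alpha> i}"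
  using \<alpha> by (cases i) (auto simp: skew_diagram_def young_diagram_def is_partition_def)

lemma skew_shape_int: "skew_shape (\<lambda>i. int (\<alpha> i)) (\<lambda>i. int (\<beta> i))"
  using \<alpha> \<beta> \<beta>\<alpha> by (auto simp: skew_shape_def is_partition_def part_contained_def)

text \<open>Read from right to left a row is weakly decreasing, so its entries \<open>k + 2\<close>
  precede its entries \<open>k + 1\<close>. For this pair the lattice condition is sharpest in the
  prefix that ends between the two groups, where it is the inequality between
  \<open>X (Suc i)\<close> and \<open>X i\<close>.\<close>

lemma lattice_word_rows:
  fixes T
  defines "X \<equiv> colcount (entry_counts \<alpha> \<beta> T)"
  assumes mono: "\<And>i j j'. j \<in> {\<beta> i<..\<alpha> i} \<Longrightarrow> j' \<in> {\<beta> i<..\<alpha> i} \<Longrightarrow> j < j' \<Longrightarrow> T i j \<le> T i j'"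
  shows "lattice_word (reverse_row_word \<alpha> \<beta> T) \<longleftrightarrow> (\<forall>i k. X (Suc i) (Suc (Suc k)) \<le> X i (Suc k))"
proof -
  define rw where "rw i = map (T i) (rev [\<beta> i + 1..<\<alpha> i + 1])" for i
  define W where "W n = concat (map rw [1..<n + 1])" for n
  have WS: "W (Suc n) = W n @ rw (Suc n)" for n by (simp add: W_def)
  have crw: "int (count_list (rw i) k) = entry_counts \<alpha> \<beta> T i k" for i k
    unfolding rw_def count_list_map_rev_upt entry_counts_def by simp
  have cW: "int (count_list (W n) k) = X n k" for n k
  proof (induction n)
    case (Suc n)
    then show ?case using crw[of "Suc n" k] by (simp add: WS X_def)
  qed (simp add: W_def X_def)
  have row: "(\<forall>q. \<forall>k\<ge>1. count_list (W i @ take q (rw (Suc i))) (k + 1) \<le> count_list (W i @ take q (rw (Suc i))) k)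
     \<longleftrightarrow> (\<forall>k. X (Suc i) (Suc (Suc k)) \<le> X i (Suc k))" (is "?L \<longleftrightarrow> ?R") for i
  proof
    assume L: ?L
    show ?R
    proof
      fix k
      let ?p = "\<beta> (Suc i)" and ?r = "\<alpha> (Suc i)"
      define S where "S = {j \<in> {?p<..?r}. T (Suc i) j \<le> Suc k}"
      \<comment> \<open>\<open>c\<close> is the last column of the row with entry at most
        \<open>Suc k\<close>. Reading only the columns after \<open>c\<close> collects every
        \<open>Suc (Suc k)\<close> of the row and no \<open>Suc k\<close>.\<close>
      define c where "c = ?p + card S"
      have S: "S = {?p<..c}" unfolding c_def
      proof (rule interval_downset)
        fix j j' assume "j' \<in> S" "?p < j" "j \<le> j'"
        then show "j \<in> S" using mono[of j "Suc i" j'] by (cases "j = j'") (auto simp: S_def)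
      qed (auto simp: S_def)
      have pr: "?p \<le> ?r" using \<beta>\<alpha> by (simp add: part_contained_def)
      have "card S \<le> card {?p<..?r}" by (rule card_mono) (auto simp: S_def)
      then have cr: "?p \<le> c" "c \<le> ?r" using pr by (auto simp: c_def)
      have "[?p + 1..<?r + 1] = [?p + 1..<c + 1] @ [c + 1..<?r + 1]"
        using cr upt_add_eq_append[of "?p + 1" "c + 1" "?r - c"] by simp
      then have tk: "take (?r - c) (rw (Suc i)) = map (T (Suc i)) (rev [c + 1..<?r + 1])"
        by (simp add: rw_def del: upt_Suc)
      have le_c: "T (Suc i) j \<le> Suc k \<longleftrightarrow> j \<le> c" if "?p < j" "j \<le> ?r" for j
      proof -
        have "j \<in> S \<longleftrightarrow> j \<in> {?p<..c}" using S by blast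
        then show ?thesis using that by (simp add: S_def)
      qed
      have "T (Suc i) j \<noteq> Suc k" if "c < j" "j \<le> ?r" for j
        using le_c[of j] cr that by auto
      then have "{j \<in> {c<..?r}. T (Suc i) j = Suc k} = {}" by auto
      moreover have "c < j" if "?p < j" "j \<le> ?r" "T (Suc i) j = Suc (Suc k)" for j
        using le_c[of j] that by auto
      then have "{j \<in> {c<..?r}. T (Suc i) j = Suc (Suc k)} = {j \<in> {?p<..?r}. T (Suc i) j = Suc (Suc k)}"
        using cr by auto
      ultimately have "count_list (take (?r - c) (rw (Suc i))) (Suc k) = 0"
        "int (count_list (take (?r - c) (rw (Suc i))) (Suc (Suc k))) = entry_counts \<alpha> \<beta> T (Suc i) (Suc (Suc k))"
        unfolding tk count_list_map_rev_upt entry_counts_def by simp_all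
      moreover have "count_list (W i @ take (?r - c) (rw (Suc i))) (Suc k + 1)
          \<le> count_list (W i @ take (?r - c) (rw (Suc i))) (Suc k)"
        using L by auto
      ultimately show "X (Suc i) (Suc (Suc k)) \<le> X i (Suc k)"
        using cW[of i "Suc k"] cW[of i "Suc (Suc k)"] by (simp add: X_def)
    qed
  next
    assume R: ?R
    show ?L
    proof (intro allI impI)
      fix q k :: nat assume "1 \<le> k"
      then obtain k' where k: "k = Suc k'" by (cases k) auto
      have "int (count_list (W i @ take q (rw (Suc i))) (k + 1)) \<le> X (Suc i) (k + 1)"
        using count_list_take_le[of q "rw (Suc i)" "k + 1"] cW[of i "k + 1"] crw[of "Suc i" "k + 1"] by (simp add: X_def)
      also have "\<dots> \<le> X i k" using R k by (simp add: X_def)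
      also have "\<dots> \<le> int (count_list (W i @ take q (rw (Suc i))) k)" using cW[of i k] by simp
      finally show "count_list (W i @ take q (rw (Suc i))) (k + 1) \<le> count_list (W i @ take q (rw (Suc i))) k"
        by simp
    qed
  qed
  have lat: "lattice_word (W n) \<longleftrightarrow> (\<forall>i<n. \<forall>k. X (Suc i) (Suc (Suc k)) \<le> X i (Suc k))" for n
  proof (induction n)
    case 0
    then show ?case by (simp add: W_def lattice_word_def)
  next
    case (Suc n)
    show ?case unfolding WS lattice_word_append Suc row by (auto simp: less_Suc_eq)
  qed
  \<comment> \<open>The word ends after \<open>part_length \<alpha>\<close> rows; the rows below are
    empty and inherit the condition.\<close>
  have "X (Suc i) (Suc (Suc k)) \<le> X i (Suc k)"
    if H: "\<forall>i<part_length \<alpha>. \<forall>k. X (Suc i) (Suc (Suc k)) \<le> X i (Suc k)" for i k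
  proof (induction i arbitrary: k)
    case 0
    show ?case
    proof (cases "part_length \<alpha> = 0")
      case True
      then have "\<alpha> (Suc 0) = 0" using is_partition_zero_beyond_length[OF \<alpha>] by simp
      then show ?thesis by (simp add: X_def entry_counts_def)
    qed (use H in simp)
  next
    case (Suc i)
    show ?case
    proof (cases "Suc i < part_length \<alpha>")
      case False
      then have "\<alpha> (Suc (Suc i)) = 0" using is_partition_zero_beyond_length[OF \<alpha>] by simp
      then have "X (Suc (Suc i)) (Suc (Suc k)) = X (Suc i) (Suc (Suc k))"
        by (simp add: X_def entry_counts_def)
      also have "\<dots> \<le> X i (Suc k)" by (rule Suc)
      also have "\<dots> \<le> X (Suc i) (Suc k)" by (simp add: X_def entry_counts_def)
      finally show ?thesis .
    qed (use H in blast)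
  qed
  then have "(\<forall>i k. X (Suc i) (Suc (Suc k)) \<le> X i (Suc k)) \<longleftrightarrow> lattice_word (W (part_length \<alpha>))"
    unfolding lat by blast
  moreover have "reverse_row_word \<alpha> \<beta> T = W (part_length \<alpha>)"
    by (simp add: reverse_row_word_def W_def rw_def[abs_def])
  ultimately show ?thesis by simp
qed

lemma
  assumes "semistandard (skew_diagram \<alpha> \<beta>) T"
  shows semistandard_pos: "j \<in> {\<beta> i<..\<alpha> i} \<Longrightarrow> 1 \<le> T i j"
    and semistandard_row: "j \<in> {\<beta> i<..\<alpha> i} \<Longrightarrow> j' \<in> {\<beta> i<..\<alpha> i} \<Longrightarrow> j \<le> j' \<Longrightarrow> T i j \<le> T i j'"
proof -
  show "j \<in> {\<beta> i<..\<alpha> i} \<Longrightarrow> 1 \<le> T i j"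
    using assms unfolding semistandard_def skew_diagram_iff by blast
  show "T i j \<le> T i j'" if "j \<in> {\<beta> i<..\<alpha> i}" "j' \<in> {\<beta> i<..\<alpha> i}" "j \<le> j'"
  proof (cases "j = j'")
    case False
    with that have "j < j'" by simp
    with that(1,2) show ?thesis using assms unfolding semistandard_def skew_diagram_iff by blast
  qed simp
qed

lemma semistandard_rowend:
  assumes T: "semistandard (skew_diagram \<alpha> \<beta>) T"
  shows "rowend (\<lambda>i. int (\<beta> i)) (entry_counts \<alpha> \<beta> T) i k = int (\<beta> i + card {j \<in> {\<beta> i<..\<alpha> i}. T i j \<le> k})"
proof (induction k)
  case 0
  have "{j \<in> {\<beta> i<..\<alpha> i}. T i j \<le> 0} = {}"
    using semistandard_pos[OF T] by fastforce
  then show ?case by simp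
next
  case (Suc k)
  have "{j \<in> {\<beta> i<..\<alpha> i}. T i j \<le> Suc k} = {j \<in> {\<beta> i<..\<alpha> i}. T i j \<le> k} \<union> {j \<in> {\<beta> i<..\<alpha> i}. T i j = Suc k}"
    by auto
  moreover have "card ({j \<in> {\<beta> i<..\<alpha> i}. T i j \<le> k} \<union> {j \<in> {\<beta> i<..\<alpha> i}. T i j = Suc k})
     = card {j \<in> {\<beta> i<..\<alpha> i}. T i j \<le> k} + card {j \<in> {\<beta> i<..\<alpha> i}. T i j = Suc k}"
    by (rule card_Un_disjoint) auto
  ultimately show ?case using Suc by (simp add: entry_counts_def)
qed

lemma semistandard_entry_le_iff:
  assumes T: "semistandard (skew_diagram \<alpha> \<beta>) T" and j: "j \<in> {\<beta> i<..\<alpha> i}"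
  shows "T i j \<le> k \<longleftrightarrow> int j \<le> rowend (\<lambda>i. int (\<beta> i)) (entry_counts \<alpha> \<beta> T) i k"
proof -
  define S where "S = {j \<in> {\<beta> i<..\<alpha> i}. T i j \<le> k}"
  have "S = {\<beta> i<..\<beta> i + card S}"
  proof (rule interval_downset)
    fix j j' assume "j' \<in> S" "\<beta> i < j" "j \<le> j'"
    then have "j \<in> {\<beta> i<..\<alpha> i}" "j' \<in> {\<beta> i<..\<alpha> i}" "T i j' \<le> k" by (auto simp: S_def)
    moreover from this have "T i j \<le> T i j'"
      using semistandard_row[OF T] \<open>j \<le> j'\<close> by blast
    ultimately show "j \<in> S" by (simp add: S_def)
  qed (auto simp: S_def)
  then have "j \<in> S \<longleftrightarrow> j \<in> {\<beta> i<..\<beta> i + card S}" by blast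
  then have "j \<in> S \<longleftrightarrow> j \<le> \<beta> i + card S" using j by simp
  then show ?thesis unfolding semistandard_rowend[OF T] of_nat_le_iff using j by (simp add: S_def)
qed

lemma entry_counts_lr_arrays:
  assumes "T \<in> lr_fillings \<alpha> \<beta>"
  shows "entry_counts \<alpha> \<beta> T \<in> lr_arrays (\<lambda>i. int (\<alpha> i)) (\<lambda>i. int (\<beta> i))"
proof -
  let ?m = "entry_counts \<alpha> \<beta> T" and ?b = "\<lambda>i. int (\<beta> i)"
  have T: "semistandard (skew_diagram \<alpha> \<beta>) T" and W: "lattice_word (reverse_row_word \<alpha> \<beta> T)"
    using assms by (auto simp: lr_fillings_def)
  have lat: "colcount ?m (Suc i) (Suc (Suc k)) \<le> colcount ?m i (Suc k)" for i k
    using W lattice_word_rows[of T] T unfolding semistandard_def skew_diagram_iff by blast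
  have nn: "0 \<le> ?m i k" for i k by (simp add: entry_counts_def)
  have ccnn: "0 \<le> colcount ?m i k" for i k
    by (induction i) (auto intro: add_nonneg_nonneg nn)
  \<comment> \<open>Stepping from row \<open>Suc i\<close> and value \<open>k\<close> to row
    \<open>i\<close> and value \<open>k - 1\<close> reaches row 0 while the value is still positive.
    This is why row \<open>i\<close> has no entry above \<open>i\<close>.\<close>
  have cc0: "colcount ?m i k = 0" if "i < k" for i k
    using that
  proof (induction i arbitrary: k)
    case (Suc i)
    define k' where "k' = k - 2"
    have k: "k = Suc (Suc k')" using Suc by (auto simp: k'_def)
    have "colcount ?m (Suc i) k \<le> 0" using lat[of i k'] Suc.IH[of "Suc k'"] Suc.prems by (simp add: k del: colcount.simps)
    then show ?case using ccnn[of "Suc i" k] by linarith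
  qed simp
  have tri: "lower_tri ?m"
    unfolding lower_tri_def
  proof (intro allI impI)
    fix i k :: nat assume "k = 0 \<or> i < k"
    then show "?m i k = 0"
    proof
      assume "k = 0"
      then have "{j \<in> {\<beta> i<..\<alpha> i}. T i j = k} = {}"
        using semistandard_pos[OF T] by fastforce
      then show ?thesis unfolding entry_counts_def by simp
    next
      assume ik: "i < k"
      show ?thesis
      proof (cases i)
        case 0
        then show ?thesis using \<alpha> by (simp add: entry_counts_def is_partition_def)
      next
        case (Suc i')
        then show ?thesis using cc0[OF ik] ccnn[of i' k] nn[of i k] by simp
      qed
    qed
  qed
  have full: "rowend ?b ?m i i = int (\<alpha> i)" for i
  proof -
    have "T i j \<le> i" if j: "j \<in> {\<beta> i<..\<alpha> i}" for j
    proof (rule ccontr)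
      assume "\<not> T i j \<le> i"
      then have "?m i (T i j) = 0" using tri by (simp add: lower_tri_def)
      then have "{j' \<in> {\<beta> i<..\<alpha> i}. T i j' = T i j} = {}" by (simp add: entry_counts_def)
      then show False using j by blast
    qed
    then have "{j \<in> {\<beta> i<..\<alpha> i}. T i j \<le> i} = {\<beta> i<..\<alpha> i}" by auto
    then show ?thesis using \<beta>\<alpha> unfolding semistandard_rowend[OF T] by (simp add: part_contained_def)
  qed
  have col: "rowend ?b ?m (Suc i) (Suc k) \<le> rowend ?b ?m i k" if i: "0 < i" for i k
  proof (rule ccontr)
    \<comment> \<open>\<open>j\<close> is the last column of row \<open>Suc i\<close> with entry at
      most \<open>Suc k\<close>. If it lay beyond the entries up to \<open>k\<close> of row
      \<open>i\<close>, the box above it would exist and hold an entry above \<open>k\<close>,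
      against column strictness.\<close>
    define j where "j = \<beta> (Suc i) + card {j \<in> {\<beta> (Suc i)<..\<alpha> (Suc i)}. T (Suc i) j \<le> Suc k}"
    have rj: "rowend ?b ?m (Suc i) (Suc k) = int j"
      unfolding j_def by (rule semistandard_rowend[OF T])
    assume "\<not> ?thesis"
    then have lt: "rowend ?b ?m i k < int j" using rj by simp
    have \<beta>i: "int (\<beta> i) \<le> rowend ?b ?m i k" unfolding semistandard_rowend[OF T] by simp
    have "card {j \<in> {\<beta> (Suc i)<..\<alpha> (Suc i)}. T (Suc i) j \<le> Suc k} \<le> card {\<beta> (Suc i)<..\<alpha> (Suc i)}"
      by (rule card_mono) auto
    then have ja: "j \<le> \<alpha> (Suc i)" using \<beta>\<alpha> unfolding j_def part_contained_def
      by (metis card_greaterThanAtMost le_diff_conv2 add.commute)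
    have mono: "\<alpha> (Suc i) \<le> \<alpha> i" "\<beta> (Suc i) \<le> \<beta> i" using \<alpha> \<beta> i by (auto simp: is_partition_def)
    have j1: "j \<in> {\<beta> i<..\<alpha> i}" and j2: "j \<in> {\<beta> (Suc i)<..\<alpha> (Suc i)}" using lt \<beta>i ja mono by auto
    have "T (Suc i) j \<le> Suc k" using semistandard_entry_le_iff[OF T j2] rj by simp
    moreover have "T i j < T (Suc i) j" using T j1 j2 unfolding semistandard_def skew_diagram_iff by blast
    ultimately have "T i j \<le> k" by simp
    then show False using semistandard_entry_le_iff[OF T j1] lt by simp
  qed
  show ?thesis
    unfolding lr_arrays_def lr_row_def using tri lat nn full col by blast
qed

text \<open>Row ends recover the tableau: the entry in column \<open>j\<close> is the least
  \<open>k\<close> whose row end reaches \<open>j\<close>.\<close>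

lemma lr_fillings_bij:
  "bij_betw (entry_counts \<alpha> \<beta>) (lr_fillings \<alpha> \<beta>) (lr_arrays (\<lambda>i. int (\<alpha> i)) (\<lambda>i. int (\<beta> i)))"
  (is "bij_betw _ _ (lr_arrays ?a ?b)")
proof (rule bij_betwI')
  fix T T' assume T: "T \<in> lr_fillings \<alpha> \<beta>" "T' \<in> lr_fillings \<alpha> \<beta>"
  show "(entry_counts \<alpha> \<beta> T = entry_counts \<alpha> \<beta> T') = (T = T')"
  proof
    assume eq: "entry_counts \<alpha> \<beta> T = entry_counts \<alpha> \<beta> T'"
    have s: "semistandard (skew_diagram \<alpha> \<beta>) T" "semistandard (skew_diagram \<alpha> \<beta>) T'"
      using T by (auto simp: lr_fillings_def)
    show "T = T'"
    proof (intro ext)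
      fix i j
      show "T i j = T' i j"
      proof (cases "j \<in> {\<beta> i<..\<alpha> i}")
        case True
        then have "T i j \<le> k \<longleftrightarrow> T' i j \<le> k" for k
          using semistandard_entry_le_iff[OF s(1) True] semistandard_entry_le_iff[OF s(2) True] eq by simp
        then show ?thesis by (meson order_antisym order_refl)
      next
        case False
        then show ?thesis using s unfolding semistandard_def skew_diagram_iff by metis
      qed
    qed
  qed simp
next
  fix T assume "T \<in> lr_fillings \<alpha> \<beta>"
  then show "entry_counts \<alpha> \<beta> T \<in> lr_arrays ?a ?b" by (rule entry_counts_lr_arrays)
next
  fix m assume m: "m \<in> lr_arrays ?a ?b"
  define T where "T i j = (if j \<in> {\<beta> i<..\<alpha> i} then LEAST k. int j \<le> rowend ?b m i k else 0)" for i j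
  have le_iff: "T i j \<le> k \<longleftrightarrow> int j \<le> rowend ?b m i k" if j: "j \<in> {\<beta> i<..\<alpha> i}" for i j k
  proof -
    have "0 < i" using j \<alpha> by (cases i) (auto simp: is_partition_def)
    then have ex: "int j \<le> rowend ?b m i i" using lr_rowend_full[OF m, of i i] j by simp
    show ?thesis
    proof
      assume "T i j \<le> k"
      moreover have "int j \<le> rowend ?b m i (T i j)"
        using LeastI[where P = "\<lambda>k. int j \<le> rowend ?b m i k", OF ex] j by (simp add: T_def)
      ultimately show "int j \<le> rowend ?b m i k" using lr_rowend_mono[OF m, of "T i j" k i] by linarith
    next
      assume "int j \<le> rowend ?b m i k"
      then show "T i j \<le> k" using j by (simp add: T_def Least_le)
    qed
  qed
  have eqm: "entry_counts \<alpha> \<beta> T = m"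
  proof (intro ext)
    fix i k
    show "entry_counts \<alpha> \<beta> T i k = m i k"
    proof (cases k)
      case 0
      have "T i j \<noteq> 0" if "j \<in> {\<beta> i<..\<alpha> i}" for j
        using le_iff[OF that, of 0] that by auto
      then have "{j \<in> {\<beta> i<..\<alpha> i}. T i j = k} = {}" using 0 by blast
      then show ?thesis using lr_tri[OF m, of k i] 0 by (simp add: entry_counts_def)
    next
      case (Suc k')
      show ?thesis
      proof (cases "i = 0")
        case True
        then show ?thesis using \<alpha> lr_tri[OF m, of k i] Suc by (simp add: entry_counts_def is_partition_def)
      next
        case False
        define p where "p = nat (rowend ?b m i k')"
        define q where "q = nat (rowend ?b m i k)"
        have ge: "int (\<beta> i) \<le> rowend ?b m i k'" "rowend ?b m i k \<le> int (\<alpha> i)"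
          "rowend ?b m i k' \<le> rowend ?b m i k"
          using lr_rowend_ge[OF m, of i k'] lr_rowend_le[OF m, of i k] lr_rowend_mono[OF m, of k' k i] False Suc by auto
        have pq: "int p = rowend ?b m i k'" "int q = rowend ?b m i k" "\<beta> i \<le> p" "q \<le> \<alpha> i" "p \<le> q"
          using ge by (auto simp: p_def q_def)
        have iff: "T i j = k \<longleftrightarrow> p < j \<and> j \<le> q" if "j \<in> {\<beta> i<..\<alpha> i}" for j
          using le_iff[OF that, of k] le_iff[OF that, of k'] pq(1,2) Suc by auto
        have "{j \<in> {\<beta> i<..\<alpha> i}. T i j = k} = {p<..q}"
        proof (intro equalityI subsetI)
          fix j assume "j \<in> {j \<in> {\<beta> i<..\<alpha> i}. T i j = k}"
          then show "j \<in> {p<..q}" using iff[of j] by simp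
        next
          fix j assume j: "j \<in> {p<..q}"
          then have "j \<in> {\<beta> i<..\<alpha> i}" using pq(3,4) by simp
          then show "j \<in> {j \<in> {\<beta> i<..\<alpha> i}. T i j = k}" using iff[of j] j by simp
        qed
        then have "entry_counts \<alpha> \<beta> T i k = int q - int p" using pq(5) by (simp add: entry_counts_def)
        then show ?thesis using pq(1,2) Suc by simp
      qed
    qed
  qed
  have row: "T i j \<le> T i j'" if "j \<in> {\<beta> i<..\<alpha> i}" "j' \<in> {\<beta> i<..\<alpha> i}" "j < j'" for i j j'
    using le_iff[OF that(1), of "T i j'"] le_iff[OF that(2), of "T i j'"] that(3) by simp
  have colstep: "T i j < T (Suc i) j" if j: "j \<in> {\<beta> i<..\<alpha> i}" "j \<in> {\<beta> (Suc i)<..\<alpha> (Suc i)}" for i j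
  proof -
    have i: "0 < i" using j \<alpha> by (cases i) (auto simp: is_partition_def)
    have "T (Suc i) j \<noteq> 0" using le_iff[OF j(2), of 0] j(2) by auto
    then obtain k where k: "T (Suc i) j = Suc k" by (cases "T (Suc i) j") auto
    then have "int j \<le> rowend ?b m (Suc i) (Suc k)" using le_iff[OF j(2), of "Suc k"] by simp
    then have "int j \<le> rowend ?b m i k" using lr_column[OF m i, of k] by linarith
    then show ?thesis using le_iff[OF j(1), of k] k by simp
  qed
  \<comment> \<open>Adjacent rows suffice because a column of a skew shape has no gaps.\<close>
  have col: "T i j < T i' j" if "i < i'" "j \<in> {\<beta> i<..\<alpha> i}" "j \<in> {\<beta> i'<..\<alpha> i'}" for i i' j
    using that(1,3)
  proof (induction i')
    case (Suc i')
    show ?case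
    proof (cases "i = i'")
      case True
      then show ?thesis using colstep Suc.prems(2) that(2) by blast
    next
      case False
      then have ii': "i < i'" using Suc.prems(1) by simp
      have "0 < i" using that(2) \<alpha> by (cases i) (auto simp: is_partition_def)
      then have "j \<in> {\<beta> i'<..\<alpha> i'}"
        using ii' Suc.prems(2) that(2) is_partition_mono[OF \<beta>, of i i'] is_partition_mono[OF \<alpha>, of i' "Suc i'"] by auto
      then show ?thesis using Suc.IH[OF ii'] colstep[of j i'] Suc.prems(2) by simp
    qed
  qed simp
  have "semistandard (skew_diagram \<alpha> \<beta>) T"
    unfolding semistandard_def skew_diagram_iff
  proof (intro conjI allI impI)
    fix i j assume j: "j \<in> {\<beta> i<..\<alpha> i}"
    show "1 \<le> T i j" using le_iff[OF j, of 0] j by (cases "T i j") auto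
  next
    fix i j assume j: "j \<notin> {\<beta> i<..\<alpha> i}"
    then show "T i j = 0" by (auto simp: T_def)
  qed (use row col in blast)+
  moreover have "lattice_word (reverse_row_word \<alpha> \<beta> T)"
    using lattice_word_rows[of T] row lr_lattice[OF m] unfolding eqm by blast
  ultimately show "\<exists>T\<in>lr_fillings \<alpha> \<beta>. m = entry_counts \<alpha> \<beta> T"
    using eqm by (auto simp: lr_fillings_def)
qed

lemma finite_lr_arrays_int: "finite (lr_arrays (\<lambda>i. int (\<alpha> i)) (\<lambda>i. int (\<beta> i)))"
proof (rule finite_lr_arrays)
  fix i assume "part_length \<alpha> < i"
  then have "\<alpha> i = 0" by (rule is_partition_zero_beyond_length[OF \<alpha>])
  then show "int (\<alpha> i) = int (\<beta> i)" using \<beta>\<alpha> by (simp add: part_contained_def) (metis le_zero_eq)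
qed

text \<open>The lattice condition makes the content of every filling a partition, so the tableaux of
  the various contents are disjoint classes that exhaust the fillings.\<close>

lemma sum_lr_coeff:
  "(\<Sum>\<nu> | is_partition \<nu> \<and> lr_coeff \<alpha> \<beta> \<nu> \<noteq> 0. lr_coeff \<alpha> \<beta> \<nu>)
     = card (lr_arrays (\<lambda>i. int (\<alpha> i)) (\<lambda>i. int (\<beta> i)))"
proof -
  define V where "V = {\<nu>. is_partition \<nu> \<and> lr_coeff \<alpha> \<beta> \<nu> \<noteq> 0}"
  have finV: "finite V" unfolding V_def by (rule finite_lr_support[OF \<alpha>])
  have coeff: "lr_coeff \<alpha> \<beta> \<nu> = card (LR_tableaux \<alpha> \<beta> \<nu>)" for \<nu>
    using \<beta>\<alpha> by (simp add: lr_coeff_def)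
  have fin: "finite (lr_fillings \<alpha> \<beta>)"
    using bij_betw_finite[OF lr_fillings_bij] finite_lr_arrays_int by simp
  have sub: "LR_tableaux \<alpha> \<beta> \<nu> \<subseteq> lr_fillings \<alpha> \<beta>" for \<nu>
    by (auto simp: LR_tableaux_def lr_fillings_def)
  have disj: "LR_tableaux \<alpha> \<beta> \<nu> \<inter> LR_tableaux \<alpha> \<beta> \<nu>' = {}" if "\<nu> \<in> V" "\<nu>' \<in> V" "\<nu> \<noteq> \<nu>'" for \<nu> \<nu>'
  proof (rule ccontr)
    assume "\<not> ?thesis"
    then obtain T where "has_content (skew_diagram \<alpha> \<beta>) T \<nu>" "has_content (skew_diagram \<alpha> \<beta>) T \<nu>'"
      by (auto simp: LR_tableaux_def)
    then have "\<nu> k = \<nu>' k" if "1 \<le> k" for k using that unfolding has_content_def by (simp add: that)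
    moreover have "\<nu> 0 = \<nu>' 0" using that by (simp add: V_def is_partition_def)
    ultimately have "\<nu> k = \<nu>' k" for k by (cases k) auto
    then show False using that by blast
  qed
  have "lr_fillings \<alpha> \<beta> \<subseteq> (\<Union>\<nu>\<in>V. LR_tableaux \<alpha> \<beta> \<nu>)"
  proof
    fix T assume T: "T \<in> lr_fillings \<alpha> \<beta>"
    let ?L = "part_length \<alpha>" and ?m = "entry_counts \<alpha> \<beta> T"
    have m: "?m \<in> lr_arrays (\<lambda>i. int (\<alpha> i)) (\<lambda>i. int (\<beta> i))" by (rule entry_counts_lr_arrays[OF T])
    define \<nu> where "\<nu> k = (if k = 0 then 0 else card {(i, j) \<in> skew_diagram \<alpha> \<beta>. T i j = k})" for k
    have cc: "colcount ?m n k = int (card {(i, j). i \<le> n \<and> j \<in> {\<beta> i<..\<alpha> i} \<and> T i j = k})" for n k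
    proof (induction n)
      case 0
      have "{(i, j). i \<le> 0 \<and> j \<in> {\<beta> i<..\<alpha> i} \<and> T i j = k} = {}"
        using \<alpha> by (auto simp: is_partition_def)
      then show ?case by (simp only: card.empty colcount.simps of_nat_0)
    next
      case (Suc n)
      have split: "{(i, j). i \<le> Suc n \<and> j \<in> {\<beta> i<..\<alpha> i} \<and> T i j = k} =
        {(i, j). i \<le> n \<and> j \<in> {\<beta> i<..\<alpha> i} \<and> T i j = k} \<union> (\<lambda>j. (Suc n, j)) ` {j \<in> {\<beta> (Suc n)<..\<alpha> (Suc n)}. T (Suc n) j = k}"
        by (auto simp: le_Suc_eq)
      have "finite {(i, j). i \<le> n \<and> j \<in> {\<beta> i<..\<alpha> i} \<and> T i j = k}"
        by (rule finite_subset[of _ "SIGMA i:{..n}. {\<beta> i<..\<alpha> i}"]) auto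
      then have "card {(i, j). i \<le> Suc n \<and> j \<in> {\<beta> i<..\<alpha> i} \<and> T i j = k} =
        card {(i, j). i \<le> n \<and> j \<in> {\<beta> i<..\<alpha> i} \<and> T i j = k} + card ((\<lambda>j. (Suc n, j)) ` {j \<in> {\<beta> (Suc n)<..\<alpha> (Suc n)}. T (Suc n) j = k})"
        unfolding split by (rule card_Un_disjoint) auto
      also have "card ((\<lambda>j. (Suc n, j)) ` {j \<in> {\<beta> (Suc n)<..\<alpha> (Suc n)}. T (Suc n) j = k}) = card {j \<in> {\<beta> (Suc n)<..\<alpha> (Suc n)}. T (Suc n) j = k}"
        by (rule card_image) (simp add: inj_on_def)
      finally show ?case using Suc by (simp add: entry_counts_def)
    qed
    have \<nu>: "int (\<nu> k) = colcount ?m ?L k" if "0 < k" for k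
    proof -
      have "{(i, j). i \<le> ?L \<and> j \<in> {\<beta> i<..\<alpha> i} \<and> T i j = k} = {(i, j) \<in> skew_diagram \<alpha> \<beta>. T i j = k}"
        unfolding skew_diagram_iff
      proof (intro equalityI subsetI, goal_cases)
        case (2 x)
        then obtain i j where x: "x = (i, j)" "j \<in> {\<beta> i<..\<alpha> i}" "T i j = k" by (auto simp: skew_diagram_iff)
        have "i \<le> ?L"
        proof (rule ccontr)
          assume "\<not> i \<le> ?L"
          then have "\<alpha> i = 0" using is_partition_zero_beyond_length[OF \<alpha>, of i] by simp
          then show False using x(2) by simp
        qed
        with x show ?case by simp
      qed (auto simp: skew_diagram_iff)
      then show ?thesis using cc[of ?L k] that by (simp add: \<nu>_def)
    qed
    have "is_partition \<nu>"
      unfolding is_partition_def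
    proof (intro conjI allI impI)
      show "\<nu> 0 = 0" by (simp add: \<nu>_def)
      show "\<nu> (k + 1) \<le> \<nu> k" if "1 \<le> k" for k
      proof -
        define k' where "k' = k - 1"
        have k: "k = Suc k'" using that by (simp add: k'_def)
        have "int (\<nu> (k + 1)) \<le> int (\<nu> k)"
          using \<nu>[of k] \<nu>[of "k + 1"] lr_colcount_partition[OF m, of ?L k'] k by simp
        then show ?thesis by simp
      qed
      have "\<nu> k = 0" if "?L < k" for k
        using \<nu>[of k] that lower_tri_colcount_zero[of ?m ?L k] m by (auto simp: lr_arrays_def)
      then have "{k. \<nu> k \<noteq> 0} \<subseteq> {..?L}" by (auto intro: leI)
      then show "finite {k. \<nu> k \<noteq> 0}" by (rule finite_subset) simp
    qed
    moreover have TL: "T \<in> LR_tableaux \<alpha> \<beta> \<nu>"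
      using T by (auto simp: LR_tableaux_def lr_fillings_def has_content_def \<nu>_def)
    moreover have "lr_coeff \<alpha> \<beta> \<nu> \<noteq> 0"
      unfolding coeff using TL finite_subset[OF sub fin] by (auto simp: card_eq_0_iff)
    ultimately show "T \<in> (\<Union>\<nu>\<in>V. LR_tableaux \<alpha> \<beta> \<nu>)" by (auto simp: V_def)
  qed
  then have eq: "lr_fillings \<alpha> \<beta> = (\<Union>\<nu>\<in>V. LR_tableaux \<alpha> \<beta> \<nu>)" using sub by blast
  have "(\<Sum>\<nu>\<in>V. lr_coeff \<alpha> \<beta> \<nu>) = (\<Sum>\<nu>\<in>V. card (LR_tableaux \<alpha> \<beta> \<nu>))"
    unfolding coeff ..
  also have "\<dots> = card (\<Union>\<nu>\<in>V. LR_tableaux \<alpha> \<beta> \<nu>)"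
    by (rule card_UN_disjoint[symmetric]) (use finV disj finite_subset[OF sub fin] in auto)
  also have "\<dots> = card (lr_arrays (\<lambda>i. int (\<alpha> i)) (\<lambda>i. int (\<beta> i)))"
    unfolding eq[symmetric] by (rule bij_betw_same_card[OF lr_fillings_bij])
  finally show ?thesis by (simp add: V_def)
qed

end

section \<open>Stretched shapes and bounded growth\<close>

section \<open>Boundedness\<close>

definition stretched :: "nat \<Rightarrow> (nat \<Rightarrow> nat) \<Rightarrow> (nat \<Rightarrow> nat) \<Rightarrow> nat \<Rightarrow> int" where
  "stretched n \<nu> \<nu>' i = int n * int (\<nu> i) + int (\<nu>' i)"

lemma stretched_Suc: "stretched (Suc n) \<nu> \<nu>' = (\<lambda>i. stretched n \<nu> \<nu>' i + int (\<nu> i))"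
  by (simp add: stretched_def fun_eq_iff algebra_simps)

lemma is_partition_stretch:
  assumes "is_partition \<nu>" "is_partition \<nu>'"
  shows "is_partition (part_add (part_scale n \<nu>) \<nu>')"
proof -
  have "{i. n * \<nu> i + \<nu>' i \<noteq> 0} \<subseteq> {i. \<nu> i \<noteq> 0} \<union> {i. \<nu>' i \<noteq> 0}" by auto
  then have "finite {i. n * \<nu> i + \<nu>' i \<noteq> 0}"
    by (rule finite_subset) (use assms in \<open>auto simp: is_partition_def\<close>)
  then show ?thesis
    using assms by (auto simp: is_partition_def part_add_def part_scale_def intro!: add_mono)
qed

text \<open>A repetition is never followed by growth, because growth would propagate back to the
  repeated step.\<close>

lemma growth_sequence_stable:
  fixes Q :: "nat \<Rightarrow> nat"
  assumes mono: "\<And>n. Q n \<le> Q (Suc n)" and grow: "\<And>n. Q (Suc n) < Q (Suc (Suc n)) \<Longrightarrow> Q n < Q (Suc n)"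
    and eq: "Q n = Q (Suc n)"
  shows "stable_from Q n"
proof -
  have "Q (n + d) = Q n \<and> Q (Suc (n + d)) = Q n" for d
  proof (induction d)
    case (Suc d)
    then show ?case using grow[of "n + d"] mono[of "Suc (n + d)"] by (metis add_Suc_right order_le_imp_less_or_eq less_irrefl)
  qed (simp add: eq)
  then show ?thesis unfolding stable_from_def by (metis le_iff_add)
qed

lemma growth_sequence_strict:
  fixes Q :: "nat \<Rightarrow> nat"
  assumes mono: "\<And>n. Q n \<le> Q (Suc n)" and grow: "\<And>n. Q (Suc n) < Q (Suc (Suc n)) \<Longrightarrow> Q n < Q (Suc n)"
    and m: "least_stable Q m" and n: "n < m"
  shows "Q n < Q (n + 1)"
proof (rule ccontr)
  assume "\<not> ?thesis"
  then have "Q n = Q (Suc n)" using mono[of n] by simp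
  then have "stable_from Q n" using growth_sequence_stable[of Q n] mono grow by blast
  then show False using m n by (auto simp: least_stable_def)
qed

lemma growth_sequence_bounded:
  fixes Q :: "nat \<Rightarrow> nat"
  assumes mono: "\<And>n. Q n \<le> Q (Suc n)" and bd: "\<And>n. Q n \<le> B"
  shows "\<exists>m. \<forall>n\<ge>m. Q n = Q m"
proof -
  have fin: "finite (range Q)" by (rule finite_subset[of _ "{..B}"]) (use bd in auto)
  then have "Max (range Q) \<in> range Q" by (intro Max_in) auto
  then obtain m where m: "Max (range Q) = Q m" by blast
  have "Q n = Q m" if "m \<le> n" for n
    using lift_Suc_mono_le[of Q, OF mono that] Max_ge[OF fin, of "Q n"] m by simp
  then show ?thesis by blast
qed

lemma rank_strict_mono:
  fixes i i' :: nat
  assumes "finite S" "i' \<in> S" "i < i'"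
  shows "card {x \<in> S. x \<le> i} < card {x \<in> S. x \<le> i'}"
proof (rule psubset_card_mono)
  have "i' \<in> {x \<in> S. x \<le> i'}" "i' \<notin> {x \<in> S. x \<le> i}" using assms by auto
  then have "{x \<in> S. x \<le> i} \<noteq> {x \<in> S. x \<le> i'}" by blast
  moreover have "{x \<in> S. x \<le> i} \<subseteq> {x \<in> S. x \<le> i'}" using assms(3) by auto
  ultimately show "{x \<in> S. x \<le> i} \<subset> {x \<in> S. x \<le> i'}" by (intro psubsetI)
qed (use assms in simp)

text \<open>Identifies the rows and columns left by \<open>delete_empty\<close> with the nonempty
  ones of the original diagram.\<close>

lemma rank_inj:
  fixes i i' :: nat
  assumes "finite S" "i \<in> S" "i' \<in> S" "card {x \<in> S. x \<le> i} = card {x \<in> S. x \<le> i'}"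
  shows "i = i'"
  using rank_strict_mono[OF assms(1), of i' i] rank_strict_mono[OF assms(1), of i i'] assms by (metis linorder_cases less_irrefl)

section \<open>The stretched family\<close>

locale stretch =
  fixes lam mu lam' mu' :: "nat \<Rightarrow> nat"
  assumes lam: "is_partition lam" and mu: "is_partition mu"
    and lam': "is_partition lam'" and mu': "is_partition mu'"
    and sub: "part_contained mu lam" and sub': "part_contained mu' lam'"
begin

abbreviation outer :: "nat \<Rightarrow> nat \<Rightarrow> int" where "outer n \<equiv> stretched n lam lam'"
abbreviation inner :: "nat \<Rightarrow> nat \<Rightarrow> int" where "inner n \<equiv> stretched n mu mu'"
abbreviation arrays :: "nat \<Rightarrow> (nat \<Rightarrow> nat \<Rightarrow> int) set" where "arrays n \<equiv> lr_arrays (outer n) (inner n)"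

lemma stretched_partition:
  "is_partition (part_add (part_scale n lam) lam')" "is_partition (part_add (part_scale n mu) mu')"
  "part_contained (part_add (part_scale n mu) mu') (part_add (part_scale n lam) lam')"
  using is_partition_stretch lam lam' mu mu' sub sub'
  by (auto simp: part_contained_def part_add_def part_scale_def intro: add_mono)

lemma stretched_eq:
  "outer n = (\<lambda>i. int (part_add (part_scale n lam) lam' i))" "inner n = (\<lambda>i. int (part_add (part_scale n mu) mu' i))"
  by (auto simp: stretched_def part_add_def part_scale_def)

lemma Q_sum_eq: "Q_sum lam mu lam' mu' n = card (arrays n)"
  unfolding Q_sum_def Let_def stretched_eq by (rule sum_lr_coeff[OF stretched_partition])

lemma finite_arrays: "finite (arrays n)"
  unfolding stretched_eq by (rule finite_lr_arrays_int[OF stretched_partition])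

lemma skew_shape_stretched: "skew_shape (outer n) (inner n)"
  unfolding stretched_eq by (rule skew_shape_int[OF stretched_partition])

lemma arrays_add:
  assumes "t \<in> lr_arrays (\<lambda>i. int (lam i)) (\<lambda>i. int (mu i))" "m \<in> arrays n"
  shows "(\<lambda>i k. m i k + t i k) \<in> arrays (Suc n)"
  using lr_arrays_add[OF assms(2,1)] by (simp add: stretched_Suc)

lemma arrays_add_inj: "inj_on (\<lambda>m i k. m i k + t i k :: int) A"
  by (auto simp: inj_on_def fun_eq_iff)

lemma Q_mono: "Q_sum lam mu lam' mu' n \<le> Q_sum lam mu lam' mu' (Suc n)"
proof -
  obtain t where "t \<in> lr_arrays (\<lambda>i. int (lam i)) (\<lambda>i. int (mu i))"
    using lr_superstandard[OF skew_shape_int[OF lam mu sub]] by blast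
  then show ?thesis unfolding Q_sum_eq
    by (intro card_inj_on_le[OF arrays_add_inj _ finite_arrays, of t]) (auto intro: arrays_add)
qed

text \<open>Adding \<open>t\<close> injects one stage into the next, so between finite sets growth
  means that some array is missed. The criterion holds for every \<open>t\<close>, which can thus be
  chosen to suit the occasion.\<close>

lemma Q_less_iff:
  assumes t: "t \<in> lr_arrays (\<lambda>i. int (lam i)) (\<lambda>i. int (mu i))"
  shows "Q_sum lam mu lam' mu' n < Q_sum lam mu lam' mu' (Suc n) \<longleftrightarrow>
    (\<exists>m\<in>arrays (Suc n). (\<lambda>i k. m i k - t i k) \<notin> arrays n)"
proof -
  let ?A = "(\<lambda>m i k. m i k + t i k) ` arrays n"
  have sub: "?A \<subseteq> arrays (Suc n)" using arrays_add[OF t] by blast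
  have card: "card ?A = card (arrays n)" by (rule card_image[OF arrays_add_inj])
  have mem: "m \<in> ?A \<longleftrightarrow> (\<lambda>i k. m i k - t i k) \<in> arrays n" for m
  proof
    assume "(\<lambda>i k. m i k - t i k) \<in> arrays n"
    then show "m \<in> ?A" by (rule rev_image_eqI) simp
  qed auto
  have "card ?A < card (arrays (Suc n)) \<longleftrightarrow> ?A \<subset> arrays (Suc n)"
  proof
    assume "card ?A < card (arrays (Suc n))"
    then have "?A \<noteq> arrays (Suc n)" by (metis less_irrefl)
    with sub show "?A \<subset> arrays (Suc n)" by (rule psubsetI)
  qed (rule psubset_card_mono[OF finite_arrays])
  also have "\<dots> \<longleftrightarrow> (\<exists>m\<in>arrays (Suc n). m \<notin> ?A)" using sub by (simp only: psubset_eq) blast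
  finally show ?thesis unfolding Q_sum_eq card mem .
qed

lemma Q_growth_propagates:
  assumes "Q_sum lam mu lam' mu' (Suc n) < Q_sum lam mu lam' mu' (Suc (Suc n))"
  shows "Q_sum lam mu lam' mu' n < Q_sum lam mu lam' mu' (Suc n)"
proof -
  obtain t where t: "t \<in> lr_arrays (\<lambda>i. int (lam i)) (\<lambda>i. int (mu i))"
    using lr_superstandard[OF skew_shape_int[OF lam mu sub]] by blast
  obtain m where m: "m \<in> arrays (Suc (Suc n))" "(\<lambda>i k. m i k - t i k) \<notin> arrays (Suc n)"
    using assms unfolding Q_less_iff[OF t] by blast
  obtain m' where "m' \<in> arrays (Suc n)"
    "\<And>a' b'. (\<And>i. inner (Suc n) i = b' i + int (mu i)) \<Longrightarrow> (\<lambda>i k. m' i k - t i k) \<notin> lr_arrays a' b'"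
    using lr_growth_propagates[OF skew_shape_stretched t _ m(2)] m(1)
    unfolding stretched_Suc[of "Suc n"] by blast
  moreover have "inner (Suc n) i = inner n i + int (mu i)" for i by (simp add: stretched_Suc)
  ultimately show ?thesis unfolding Q_less_iff[OF t] by blast
qed

section \<open>Diagrams whose nonempty rows start, or end, in a common column\<close>

lemma skew_box_iff: "(i, j) \<in> skew_diagram lam mu \<longleftrightarrow> mu i < j \<and> j \<le> lam i"
  using skew_diagram_iff[OF lam mu sub] by simp

lemma finite_skew: "finite (skew_diagram lam mu)"
  using finite_young_diagram[OF lam] by (simp add: skew_diagram_def)

text \<open>Every nonempty row of a Young diagram has a box in column 1. In the original diagram
  this is a box in the leftmost nonempty column, hence the first box of its row.\<close>

lemma partition_diagram_inner_const:
  assumes "diagram_is_partition (skew_diagram lam mu)"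
  shows "\<exists>c. \<forall>i. mu i < lam i \<longrightarrow> mu i = c"
proof -
  let ?D = "skew_diagram lam mu"
  obtain \<nu> where \<nu>: "delete_empty ?D = young_diagram \<nu>"
    using assms by (auto simp: diagram_is_partition_def)
  define R where "R i = card {x \<in> fst ` ?D. x \<le> i}" for i
  define C where "C j = card {x \<in> snd ` ?D. x \<le> j}" for j
  have del: "delete_empty ?D = (\<lambda>(i, j). (R i, C j)) ` ?D"
    by (simp add: delete_empty_def R_def C_def)
  have fin: "finite (fst ` ?D)" "finite (snd ` ?D)" using finite_skew by auto
  have "mu i = Min (snd ` ?D) - 1" if i: "mu i < lam i" for i
  proof -
    have box: "(i, mu i + 1) \<in> ?D" using i by (simp add: skew_box_iff)
    then have "(R i, C (mu i + 1)) \<in> young_diagram \<nu>" unfolding \<nu>[symmetric] del by force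
    then have "(R i, 1) \<in> young_diagram \<nu>" by (auto simp: young_diagram_def)
    then obtain i2 j2 where 2: "(i2, j2) \<in> ?D" "R i2 = R i" "C j2 = 1"
      unfolding \<nu>[symmetric] del by auto
    have ii: "i2 = i" by (rule rank_inj[OF fin(1)]) (use 2 box in \<open>force simp: R_def\<close>)+
    have mem: "j2 \<in> snd ` ?D" "mu i + 1 \<in> snd ` ?D" using 2(1) box by force+
    have "j2 = Min (snd ` ?D)"
    proof (rule ccontr)
      assume "j2 \<noteq> Min (snd ` ?D)"
      moreover have "Min (snd ` ?D) \<le> j2" using fin mem by simp
      moreover have "Min (snd ` ?D) \<in> snd ` ?D" using fin mem by (intro Min_in) auto
      ultimately have "{Min (snd ` ?D), j2} \<subseteq> {x \<in> snd ` ?D. x \<le> j2}" "card {Min (snd ` ?D), j2} = 2"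
        using mem by auto
      moreover have "finite {x \<in> snd ` ?D. x \<le> j2}" using fin by simp
      ultimately have "2 \<le> C j2" unfolding C_def using card_mono by metis
      then show False using 2(3) by simp
    qed
    moreover have "mu i < j2" using 2(1) ii by (simp add: skew_box_iff)
    moreover have "Min (snd ` ?D) \<le> mu i + 1" using fin mem by simp
    ultimately show ?thesis by simp
  qed
  then show ?thesis by blast
qed

text \<open>Rotation turns column 1 of the Young diagram into column \<open>s - 1\<close>, the last
  one, so every nonempty row has a box in the rightmost nonempty column.\<close>

lemma rotated_diagram_outer_const:
  assumes "diagram_is_rotated_partition (skew_diagram lam mu)"
  shows "\<exists>c. \<forall>i. mu i < lam i \<longrightarrow> lam i = c"
proof -
  let ?D = "skew_diagram lam mu"
  obtain \<nu> r s where \<nu>: "delete_empty ?D = (\<lambda>(i, j). (r - i, s - j)) ` young_diagram \<nu>"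
    using assms by (auto simp: diagram_is_rotated_partition_def)
  define R where "R i = card {x \<in> fst ` ?D. x \<le> i}" for i
  define C where "C j = card {x \<in> snd ` ?D. x \<le> j}" for j
  have del: "delete_empty ?D = (\<lambda>(i, j). (R i, C j)) ` ?D"
    by (simp add: delete_empty_def R_def C_def)
  have fin: "finite (fst ` ?D)" "finite (snd ` ?D)" using finite_skew by auto
  have "lam i = Max (snd ` ?D)" if i: "mu i < lam i" for i
  proof -
    have box: "(i, lam i) \<in> ?D" using i by (simp add: skew_box_iff)
    then have "(R i, C (lam i)) \<in> (\<lambda>(i, j). (r - i, s - j)) ` young_diagram \<nu>" unfolding \<nu>[symmetric] del by force
    then obtain p q where pq: "(p, q) \<in> young_diagram \<nu>" "R i = r - p" by auto
    then have "(p, 1) \<in> young_diagram \<nu>" by (auto simp: young_diagram_def)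
    then have "(R i, s - 1) \<in> (\<lambda>(i, j). (R i, C j)) ` ?D"
      unfolding del[symmetric] \<nu> using pq(2) by force
    then obtain i2 j2 where 2: "(i2, j2) \<in> ?D" "R i2 = R i" "C j2 = s - 1" by auto
    have ii: "i2 = i" by (rule rank_inj[OF fin(1)]) (use 2 box in \<open>force simp: R_def\<close>)+
    have mem: "j2 \<in> snd ` ?D" "lam i \<in> snd ` ?D" using 2(1) box by force+
    have "Max (snd ` ?D) \<in> snd ` ?D" using fin mem by (intro Max_in) auto
    then obtain i3 where i3: "(i3, Max (snd ` ?D)) \<in> ?D" by force
    then have "(R i3, C (Max (snd ` ?D))) \<in> (\<lambda>(i, j). (r - i, s - j)) ` young_diagram \<nu>"
      unfolding \<nu>[symmetric] del by force
    then have "C (Max (snd ` ?D)) \<le> s - 1" by (auto simp: young_diagram_def)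
    then have "\<not> j2 < Max (snd ` ?D)"
      using rank_strict_mono[OF fin(2), of "Max (snd ` ?D)" j2] \<open>Max (snd ` ?D) \<in> snd ` ?D\<close> 2(3) unfolding C_def by linarith
    moreover have "lam i \<le> Max (snd ` ?D)" using fin mem by simp
    moreover have "j2 \<le> lam i" using 2(1) ii by (simp add: skew_box_iff)
    ultimately show ?thesis by simp
  qed
  then show ?thesis by blast
qed

text \<open>An array is determined by its row ends. Measured from the reference \<open>z n\<close>
  they form a table with bounded entries, and the finite set of such tables is the same for all
  \<open>n\<close>.\<close>

lemma Q_bounded_if_rowend_bounded:
  assumes L: "\<And>i. L < i \<Longrightarrow> lam i = 0 \<and> lam' i = 0"
    and bd: "\<And>n m i k. m \<in> arrays n \<Longrightarrow> 1 \<le> i \<Longrightarrow> i \<le> L \<Longrightarrow> k \<le> L \<Longrightarrow> \<bar>rowend (inner n) m i k - z n i k\<bar> \<le> C"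
  shows "\<exists>B. \<forall>n. Q_sum lam mu lam' mu' n \<le> B"
proof -
  define F where "F = {m :: nat \<Rightarrow> nat \<Rightarrow> int. \<forall>i k. (i \<le> L \<and> k \<le> L \<longrightarrow> \<bar>m i k\<bar> \<le> \<bar>C\<bar>) \<and> (\<not> (i \<le> L \<and> k \<le> L) \<longrightarrow> m i k = 0)}"
  have finF: "finite F" unfolding F_def by (rule finite_bounded_arrays)
  have "card (arrays n) \<le> card F" for n
  proof (rule card_inj_on_le)
    let ?g = "\<lambda>m i k. if 1 \<le> i \<and> i \<le> L \<and> k \<le> L then rowend (inner n) m i k - z n i k else 0"
    show "?g ` arrays n \<subseteq> F"
    proof clarify
      fix m assume "m \<in> arrays n"
      then have "\<bar>?g m i k\<bar> \<le> \<bar>C\<bar>" for i k using bd[of m n i k] by auto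
      moreover have "?g m i k = 0" if "\<not> (i \<le> L \<and> k \<le> L)" for i k using that by auto
      ultimately show "?g m \<in> F" unfolding F_def by blast
    qed
    show "inj_on ?g (arrays n)"
    proof (rule inj_onI, intro ext)
      fix m m' i k assume m: "m \<in> arrays n" "m' \<in> arrays n" and eq: "?g m = ?g m'"
      have re: "rowend (inner n) m i k = rowend (inner n) m' i k" if "1 \<le> i" "i \<le> L" "k \<le> L" for i k
        using fun_cong[OF fun_cong[OF eq, of i], of k] that by simp
      show "m i k = m' i k"
      proof (cases "1 \<le> k \<and> k \<le> i")
        case False
        then have "k = 0 \<or> i < k" by auto
        then show ?thesis using lr_tri[OF m(1), of k i] lr_tri[OF m(2), of k i] by simp
      next
        case True
        define k' where "k' = k - 1"
        have k: "k = Suc k'" using True by (simp add: k'_def)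
        show ?thesis
        proof (cases "i \<le> L")
          case iL: True
          then show ?thesis using re[of i k] re[of i k'] True k by simp
        next
          case False
          have "mu i \<le> lam i" "mu' i \<le> lam' i" using sub sub' by (auto simp: part_contained_def)
          then have z: "outer n i = 0" "inner n i = 0"
            using L[of i] False by (auto simp: stretched_def)
          have zero: "x i k = 0" if x: "x \<in> arrays n" for x
            using lr_rowend_le[OF x, of i k] lr_rowend_ge[OF x, of i k'] lr_nonneg[OF x, of i k] z True k by simp
          show ?thesis using zero[OF m(1)] zero[OF m(2)] by simp
        qed
      qed
    qed
  qed (rule finF)
  then show ?thesis unfolding Q_sum_eq by blast
qed

text \<open>Column strictness bounds the row end of \<open>k\<close> in row \<open>i\<close> by the
  inner shape in row \<open>i - k\<close>, whence the reference. If the rows of lam/mu start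
  together, the inner shape in row \<open>i\<close> is a matching lower bound; if they end together,
  a count of large entries supplies one.\<close>

lemma Q_bounded:
  assumes "(\<exists>c. \<forall>i. mu i < lam i \<longrightarrow> mu i = c) \<or> (\<exists>c. \<forall>i. mu i < lam i \<longrightarrow> lam i = c)"
  shows "\<exists>B. \<forall>n. Q_sum lam mu lam' mu' n \<le> B"
proof -
  define L where "L = max (part_length lam) (part_length lam')"
  have L: "lam i = 0 \<and> lam' i = 0" if "L < i" for i
    using that is_partition_zero_beyond_length[OF lam, of i] is_partition_zero_beyond_length[OF lam', of i] by (simp add: L_def)
  define C where "C = (\<Sum>r<L. int (lam' (Suc r)))"
  have Cp: "(\<Sum>r<p. int (lam' (Suc r))) \<le> C" if "p \<le> L" for p
    unfolding C_def by (rule sum_mono2) (use that in auto)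
  have C0: "0 \<le> C" by (simp add: C_def sum_nonneg)
  have C1: "int (lam' i) \<le> C" if i: "1 \<le> i" "i \<le> L" for i
  proof -
    have "int (lam' (Suc (i - 1))) \<le> C"
      unfolding C_def by (rule member_le_sum[where f = "\<lambda>r. int (lam' (Suc r))"]) (use i in auto)
    then show ?thesis using i by simp
  qed
  have le: "mu i \<le> lam i" and le': "mu' i \<le> lam' i" for i
    using sub sub' by (auto simp: part_contained_def)
  have C1': "int (mu' i) \<le> C" if "1 \<le> i" "i \<le> L" for i using C1[OF that] le'[of i] by linarith
  define a0 where "a0 = (LEAST i. mu i < lam i)"
  have empty: "lam i = mu i" if "i < a0" for i
    using not_less_Least[of i "\<lambda>i. mu i < lam i"] that le[of i] by (simp add: a0_def)
  \<comment> \<open>\<open>a0\<close> is the first nonempty row of lam/mu. If \<open>i - k\<close>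
    lies above it, row \<open>i\<close> has only boundedly many entries above \<open>k\<close>, and
    the reference is the end of the whole row.\<close>
  define z where "z n i k = int n * int (if mu i < lam i \<and> a0 + k \<le> i then mu (i - k) else lam i)" for n i k
  have "\<bar>rowend (inner n) m i k - z n i k\<bar> \<le> 2 * C"
    if m: "m \<in> arrays n" and i: "1 \<le> i" "i \<le> L" for n m i k
  proof -
    have ub: "rowend (inner n) m i k \<le> outer n i" using lr_rowend_le[OF m, of i k] i by simp
    have lb: "inner n i \<le> rowend (inner n) m i k" by (rule lr_rowend_ge[OF m])
    have nn: "0 \<le> outer n (Suc r) - rowend (inner n) m (Suc r) k" for r k
      using lr_rowend_le[OF m, of "Suc r" k] by simp
    show ?thesis
    proof (cases "mu i < lam i")
      case False
      then have "lam i = mu i" using le[of i] by simp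
      then show ?thesis using ub lb C1[OF i] by (simp add: z_def stretched_def)
    next
      case ne: True
      have a0: "mu a0 < lam a0" "a0 \<le> i"
        using LeastI[of "\<lambda>i. mu i < lam i", OF ne] Least_le[of "\<lambda>i. mu i < lam i", OF ne] by (auto simp: a0_def)
      have a0p: "1 \<le> a0" using a0 lam by (cases a0) (auto simp: is_partition_def)
      show ?thesis
      proof (cases "a0 + k \<le> i")
        case False
        then have z: "z n i k = int n * int (lam i)" by (simp add: z_def)
        \<comment> \<open>The entries above \<open>k\<close> in row \<open>i\<close> are at most as
          many as the boxes in the first \<open>p\<close> rows. As lam/mu is empty there, this
          number does not grow with \<open>n\<close>.\<close>
        have "outer n i - rowend (inner n) m i k \<le> C"
        proof (cases "i \<le> k")
          case True
          then show ?thesis using lr_rowend_full[OF m, of i k] i C0 by simp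
        next
          case ki: False
          define p where "p = i - k"
          have p: "i = p + k" "p < a0" "p \<le> L" using ki False i by (auto simp: p_def)
          have "outer n (Suc (i - 1)) - rowend (inner n) m (Suc (i - 1)) k \<le>
             (\<Sum>r<i. outer n (Suc r) - rowend (inner n) m (Suc r) k)"
            by (rule member_le_sum[where f = "\<lambda>r. outer n (Suc r) - rowend (inner n) m (Suc r) k"]) (use i nn in auto)
          also have "\<dots> \<le> (\<Sum>r<p. outer n (Suc r) - inner n (Suc r))"
            using lr_large_entries_chain[OF m, where i = p and d = k and k = 0] p by simp
          also have "\<dots> \<le> (\<Sum>r<p. int (lam' (Suc r)))"
            by (rule sum_mono) (use empty p in \<open>simp add: stretched_def\<close>)
          also have "\<dots> \<le> C" by (rule Cp) (use p in simp)
          finally show ?thesis using i by simp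
        qed
        then show ?thesis using ub C1[OF i] unfolding z by (simp add: stretched_def abs_le_iff)
      next
        case True
        define p where "p = i - k"
        have p: "i = p + k" "a0 \<le> p" "1 \<le> p" "p \<le> L" using True i a0p by (auto simp: p_def)
        have z: "z n i k = int n * int (mu p)" using ne True by (simp add: z_def p_def)
        have "rowend (inner n) m i k \<le> inner n p"
          using lr_column_chain[OF m, of p k 0] p by simp
        then have up: "rowend (inner n) m i k - z n i k \<le> C"
          using C1'[of p] p unfolding z by (simp add: stretched_def)
        have "z n i k - rowend (inner n) m i k \<le> 2 * C"
          using assms
        proof
          assume "\<exists>c. \<forall>i. mu i < lam i \<longrightarrow> mu i = c"
          then have "mu a0 = mu i" using a0 ne by metis
          then have "mu p = mu i"
            using is_partition_mono[OF mu, of a0 p] is_partition_mono[OF mu, of p i] p a0p by simp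
          then show ?thesis using lb C0 unfolding z by (simp add: stretched_def)
        next
          assume "\<exists>c. \<forall>i. mu i < lam i \<longrightarrow> lam i = c"
          then have c0: "lam a0 = lam i" using a0 ne by metis
          have c: "lam q = lam i" if "a0 \<le> q" "q \<le> i" for q
            using is_partition_mono[OF lam, of a0 q] is_partition_mono[OF lam, of q i] that a0p c0 by simp
          \<comment> \<open>\<open>f r\<close> counts the entries above \<open>k\<close> in row
            \<open>Suc (r + k)\<close>, and \<open>g r\<close> the boxes of row
            \<open>Suc r\<close>. The sum of \<open>f\<close> over \<open>r < p\<close> is at most
            that of \<open>g\<close>; since each earlier \<open>f r\<close> falls short of
            \<open>g r\<close> by a bounded amount at most, the last \<open>f\<close> exceeds the
            last \<open>g\<close> by a bounded amount at most.\<close>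
          define f where "f r = outer n (Suc (r + k)) - rowend (inner n) m (Suc (r + k)) k" for r
          define g where "g r = outer n (Suc r) - inner n (Suc r)" for r
          have "(\<Sum>r<p. f r) = (\<Sum>r\<in>{k..<p + k}. outer n (Suc r) - rowend (inner n) m (Suc r) k)"
            unfolding f_def using sum.shift_bounds_nat_ivl[of "\<lambda>r. outer n (Suc r) - rowend (inner n) m (Suc r) k" 0 k p]
            by (simp add: lessThan_atLeast0)
          also have "\<dots> \<le> (\<Sum>r<p + k. outer n (Suc r) - rowend (inner n) m (Suc r) k)"
            by (rule sum_mono2) (use nn in auto)
          also have "\<dots> \<le> (\<Sum>r<p. g r)"
            using lr_large_entries_chain[OF m, where i = p and d = k and k = 0] by (simp add: g_def)
          finally have fg: "(\<Sum>r<p. f r) \<le> (\<Sum>r<p. g r)" .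
          define p' where "p' = p - 1"
          have p': "p = Suc p'" using p by (simp add: p'_def)
          have diff: "g r - f r \<le> int (lam' (Suc r))" if r: "r < p'" for r
          proof (cases "Suc r < a0")
            case True
            have "g r \<le> int (lam' (Suc r))" using empty[OF True] by (simp add: g_def stretched_def)
            moreover have "0 \<le> f r" using nn[of "r + k" k] by (simp add: f_def)
            ultimately show ?thesis by simp
          next
            case False
            have "rowend (inner n) m (Suc (r + k)) k \<le> inner n (Suc r)"
              using lr_column_chain[OF m, of "Suc r" k 0] by simp
            then have "g r - f r \<le> outer n (Suc r) - outer n (Suc (r + k))" by (simp add: f_def g_def)
            also have "\<dots> \<le> int (lam' (Suc r))"
              using c[of "Suc r"] c[of "Suc (r + k)"] False r p p' by (simp add: stretched_def)
            finally show ?thesis .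
          qed
          have "f p' \<le> g p' + (\<Sum>r<p'. g r - f r)" using fg by (simp add: p' sum_subtractf)
          also have "(\<Sum>r<p'. g r - f r) \<le> (\<Sum>r<p'. int (lam' (Suc r)))"
            by (rule sum_mono) (use diff in simp)
          also have "\<dots> \<le> C" by (rule Cp) (use p p' in simp)
          finally have "f p' \<le> g p' + C" by simp
          then have "outer n i - rowend (inner n) m i k \<le> outer n p - inner n p + C"
            using p p' by (simp add: f_def g_def)
          then have "inner n p - rowend (inner n) m i k \<le> outer n p - outer n i + C" by linarith
          also have "outer n p - outer n i \<le> C"
            using c[of p] p C1[of p] by (simp add: stretched_def)
          finally show ?thesis unfolding z by (simp add: stretched_def)
        qed
        then show ?thesis using up C0 by linarith
      qed
    qed
  qed
  then show ?thesis by (intro Q_bounded_if_rowend_bounded[OF L, where z = z and C = "2 * C"]) auto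
qed

end

section \<open>The exact index when lam/mu is a Young diagram below empty rows\<close>

section \<open>The stability index\<close>

text \<open>Entries 1 occupy distinct columns, here within the interval from \<open>b i\<close> to
  \<open>a 1\<close>.\<close>

lemma lr_ones_le:
  assumes m: "m \<in> lr_arrays a b" and i: "0 < i"
  shows "colcount m i 1 \<le> a 1 - b i"
  using i
proof (induction i)
  case (Suc i)
  show ?case
  proof (cases "i = 0")
    case True
    then show ?thesis using lr_rowend_full[OF m, of 1 1] by simp
  next
    case False
    then show ?thesis using Suc lr_column[OF m, of i 0] by simp
  qed
qed simp

text \<open>The entries \<open>Suc k\<close> in rows \<open>Suc i\<close> to
  \<open>Suc i + d\<close> form a horizontal strip. Its columns lie to the right of the smaller
  entries of the lowest row and within the length of the top one.\<close>

lemma lr_colcount_strip: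
  assumes m: "m \<in> lr_arrays a b"
  shows "colcount m (Suc i + d) (Suc k) - colcount m i (Suc k) \<le> a (Suc i) - rowend b m (Suc i + d) k"
proof (induction d)
  case 0
  then show ?case using lr_rowend_le[OF m, of "Suc i" "Suc k"] by simp
next
  case (Suc d)
  then show ?case using lr_column[OF m, of "Suc i + d" k] by simp
qed

text \<open>The special family, with \<open>p\<close> for the number of leading rows that lam and mu
  share; below them mu vanishes and lam/mu is a Young diagram.\<close>

locale stretch_block = stretch +
  fixes p :: nat
  assumes top: "\<And>i. 1 \<le> i \<Longrightarrow> i \<le> p \<Longrightarrow> lam i = lam (Suc p) \<and> mu i = lam (Suc p)"
    and bot: "\<And>i. p < i \<Longrightarrow> mu i = 0"
begin

text \<open>The superstandard filling of lam/mu: row \<open>k\<close> of the Young diagram consists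
  of entries \<open>k\<close>.\<close>

definition block :: "nat \<Rightarrow> nat \<Rightarrow> int" where
  "block i k = (if 1 \<le> k \<and> i = p + k then int (lam i) else 0)"

text \<open>Bounds the number of entries 1 in the first \<open>p\<close> rows, independently of
  \<open>n\<close> because lam/mu is empty there. The value 0 at \<open>p = 0\<close> matches the
  convention that \<open>mu'\<close> at index 0 stands for \<open>lam' 1\<close>.\<close>

definition top_ones :: int where
  "top_ones = (if p = 0 then 0 else int (lam' 1) - int (mu' p))"

text \<open>The numerator of the stability bound for \<open>i = p + j\<close>: the amount by which
  lam'/mu' can reduce the lattice slack between \<open>j\<close> and \<open>Suc j\<close>, against a
  gain of \<open>n\<close> times the drop of \<open>lam\<close> after row \<open>i\<close>.\<close>

definition deficit :: "nat \<Rightarrow> int" where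
  "deficit i = top_ones + int (mu' (Suc p)) + int (lam' (Suc i)) - int (lam' i)"

lemma colcount_block: "colcount block i k = (if 1 \<le> k \<and> p + k \<le> i then int (lam (p + k)) else 0)"
  by (induction i) (auto simp: block_def le_Suc_eq)

lemma rowend_block:
  "rowend (\<lambda>i. int (mu i)) block i k = int (mu i) + (if p < i \<and> i \<le> p + k then int (lam i) else 0)"
  by (induction k) (auto simp: block_def le_Suc_eq)

lemma lam_mono: "1 \<le> i \<Longrightarrow> i \<le> j \<Longrightarrow> lam j \<le> lam i"
  by (rule is_partition_mono[OF lam])

lemma block_lr: "block \<in> lr_arrays (\<lambda>i. int (lam i)) (\<lambda>i. int (mu i))"
  unfolding lr_arrays_def lr_row_def mem_Collect_eq
proof (intro conjI allI impI)
  show "lower_tri block" by (auto simp: lower_tri_def block_def)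
  fix i k
  show "0 \<le> block (Suc i) k" by (simp add: block_def)
  show "rowend (\<lambda>i. int (mu i)) block (Suc i) (Suc i) = int (lam (Suc i))"
    unfolding rowend_block using top[of "Suc i"] bot[of "Suc i"] by auto
  show "colcount block (Suc i) (Suc (Suc k)) \<le> colcount block i (Suc k)"
    unfolding colcount_block using lam_mono[of "Suc (p + k)" "Suc (Suc (p + k))"] by auto
  show "rowend (\<lambda>i. int (mu i)) block (Suc i) (Suc k) \<le> rowend (\<lambda>i. int (mu i)) block i k" if "0 < i"
  proof (cases i p rule: linorder_cases)
    case less
    then show ?thesis unfolding rowend_block using top[of i] top[of "Suc i"] that by auto
  next
    case equal
    then show ?thesis unfolding rowend_block using top[of i] bot[of "Suc i"] that by auto
  next
    case greater
    then show ?thesis unfolding rowend_block using bot[of i] bot[of "Suc i"] lam_mono[of i "Suc i"] that by auto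
  qed
qed

lemma inner_nonneg: "0 \<le> inner n i" by (simp add: stretched_def)

lemma inner_below: "p < i \<Longrightarrow> inner n i = int (mu' i)"
  using bot[of i] by (simp add: stretched_def)

lemma outer_top: "0 < p \<Longrightarrow> outer n 1 - inner n p = top_ones"
  using top[of 1] top[of p] by (simp add: stretched_def top_ones_def)

section \<open>Slack estimates at one stage\<close>

context
  fixes n m
  assumes m: "m \<in> arrays n"
begin

lemma top_ones_ge: "colcount m p 1 \<le> top_ones"
proof (cases "p = 0")
  case False
  then show ?thesis using lr_ones_le[OF m, of p] outer_top[of n] by simp
next
  case True
  then show ?thesis unfolding top_ones_def by simp
qed

lemma top_ones_ge_diag: "colcount m (p + d) (Suc d) \<le> top_ones"
  using lr_lattice_chain[OF m, of 1 p d] top_ones_ge by simp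

lemma block_row_right: "outer n (Suc (p + d)) - rowend (inner n) m (Suc (p + d)) (Suc d) \<le> colcount m (p + d) (Suc d)"
  using lr_tail[OF m, of "Suc d" "p + d"] by simp

lemma block_row_left: "rowend (inner n) m (Suc (p + d)) d \<le> int (mu' (Suc p))"
  using lr_column_chain[OF m, of "Suc p" d 0] inner_below[of "Suc p" n] by simp

text \<open>Row \<open>Suc (p + d)\<close> consists mostly of \<open>Suc d\<close>: larger entries
  are limited by the lattice condition, smaller ones by column strictness.\<close>

lemma block_entry_ge:
  "outer n (Suc (p + d)) - colcount m (p + d) (Suc d) - int (mu' (Suc p)) \<le> m (Suc (p + d)) (Suc d)"
  using block_row_right[of d] block_row_left[of d] by simp

text \<open>With \<open>q = Suc (p + d)\<close>: at least \<open>outer n q - mu' (Suc p)\<close>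
  entries \<open>Suc d\<close> occur up to row \<open>q\<close>, at most \<open>top_ones\<close>
  entries \<open>Suc (Suc d)\<close> do, and the later ones form a horizontal strip of width at most
  \<open>outer n (Suc q)\<close>.\<close>

lemma block_lattice_slack:
  assumes i: "Suc (p + d) \<le> i"
  shows "int n * (int (lam (Suc (p + d))) - int (lam (Suc (Suc (p + d))))) - deficit (Suc (p + d))
    \<le> colcount m i (Suc d) - colcount m (Suc i) (Suc (Suc d))"
proof -
  define q where "q = Suc (p + d)"
  have "outer n q - int (mu' (Suc p)) \<le> colcount m q (Suc d)"
    using block_entry_ge[of d] by (simp add: q_def)
  also have "\<dots> \<le> colcount m i (Suc d)" by (rule lr_colcount_mono[OF m]) (use i in \<open>simp add: q_def\<close>)
  finally have 1: "outer n q - int (mu' (Suc p)) \<le> colcount m i (Suc d)" .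
  have "Suc i = Suc q + (i - q)" using i by (simp add: q_def)
  then have "colcount m (Suc i) (Suc (Suc d)) - colcount m q (Suc (Suc d)) \<le> outer n (Suc q)"
    using lr_colcount_strip[OF m, of q "i - q" "Suc d"] lr_rowend_ge[OF m, of "Suc q + (i - q)" "Suc d"]
      inner_nonneg[of n "Suc q + (i - q)"] by simp
  moreover have "colcount m q (Suc (Suc d)) \<le> top_ones" using top_ones_ge_diag[of "Suc d"] by (simp add: q_def)
  ultimately have "colcount m (Suc i) (Suc (Suc d)) \<le> top_ones + outer n (Suc q)" by simp
  with 1 show ?thesis unfolding q_def[symmetric] by (simp add: stretched_def deficit_def algebra_simps)
qed

text \<open>The estimate beats the stated bound by \<open>mu' (Suc p)\<close>. In this form one
  inequality serves both the lattice and the column condition.\<close>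

lemma block_column_slack:
  assumes k: "Suc d \<le> k"
  shows "int n * (int (lam (Suc (p + d))) - int (lam (Suc (Suc (p + d))))) - deficit (Suc (p + d))
    \<le> rowend (inner n) m (Suc (p + d)) k - rowend (inner n) m (Suc (Suc (p + d))) (Suc k)"
proof -
  define q where "q = Suc (p + d)"
  have "outer n q - top_ones \<le> rowend (inner n) m q (Suc d)"
    using block_row_right[of d] top_ones_ge_diag[of d] by (simp add: q_def)
  also have "\<dots> \<le> rowend (inner n) m q k" by (rule lr_rowend_mono[OF m k])
  finally have "outer n q - top_ones \<le> rowend (inner n) m q k" .
  moreover have "rowend (inner n) m (Suc q) (Suc k) \<le> outer n (Suc q)" by (rule lr_rowend_le[OF m]) simp
  ultimately show ?thesis unfolding q_def[symmetric] by (simp add: stretched_def deficit_def algebra_simps)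
qed

end

text \<open>Nonnegativity after subtraction of \<open>block\<close> follows from the inequality at
  the last row of the run of parts equal to \<open>lam i\<close>, since \<open>lam'\<close> does not
  increase along the run.\<close>

lemma block_entry_large:
  assumes bd: "\<And>i. p < i \<Longrightarrow> lam (Suc i) < lam i \<Longrightarrow> deficit i \<le> int n * (int (lam i) - int (lam (Suc i)))"
    and i: "p < i" and pos: "0 < lam i"
  shows "top_ones + int (mu' (Suc p)) \<le> int n * int (lam i) + int (lam' i)"
proof -
  have "\<exists>d. lam (Suc (i + d)) < lam (i + d) \<and> lam (i + d) = lam i"
  proof (rule ccontr)
    assume no: "\<not> ?thesis"
    have "lam (i + d) = lam i" for d
    proof (induction d)
      case (Suc d)
      have "\<not> lam (Suc (i + d)) < lam (i + d)" using no Suc by blast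
      then show ?case using lam_mono[of "i + d" "Suc (i + d)"] i Suc by simp
    qed simp
    from this[of "Suc (part_length lam)"] show False
      using is_partition_zero_beyond_length[OF lam, of "i + Suc (part_length lam)"] pos by simp
  qed
  then obtain d where d: "lam (Suc (i + d)) < lam (i + d)" "lam (i + d) = lam i" by blast
  have "deficit (i + d) \<le> int n * (int (lam (i + d)) - int (lam (Suc (i + d))))"
    using bd[of "i + d"] d i by simp
  also have "\<dots> \<le> int n * int (lam i)" using d by (intro mult_left_mono) auto
  finally have "deficit (i + d) \<le> int n * int (lam i)" .
  moreover have "lam' (i + d) \<le> lam' i" using is_partition_mono[OF lam', of i "i + d"] i by simp
  ultimately show ?thesis by (simp add: deficit_def)
qed

text \<open>Subtraction endangers only the conditions that \<open>block\<close> satisfies strictly.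
  In each of them an array of stage \<open>Suc n\<close> has at least as much slack as
  \<open>block\<close>.\<close>

lemma arrays_diff_block:
  assumes bd: "\<And>i. p < i \<Longrightarrow> lam (Suc i) < lam i \<Longrightarrow> deficit i \<le> int n * (int (lam i) - int (lam (Suc i)))"
    and m: "m \<in> arrays (Suc n)"
  shows "(\<lambda>i k. m i k - block i k) \<in> arrays n"
proof -
  have re: "rowend (inner n) (\<lambda>i k. m i k - block i k) i k =
      rowend (inner (Suc n)) m i k - rowend (\<lambda>i. int (mu i)) block i k" for i k
    using rowend_diff[of "inner (Suc n)" "\<lambda>i. int (mu i)" m block i k] by (simp add: stretched_Suc)
  have tri: "lower_tri (\<lambda>i k. m i k - block i k)"
    using lr_tri[OF m] lr_tri[OF block_lr] by (simp add: lower_tri_def)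
  \<comment> \<open>The additional stage contributes one drop of \<open>lam\<close>, which is
    precisely the slack of \<open>block\<close>.\<close>
  have slack: "int (lam q) - int (lam (Suc q)) \<le> int (Suc n) * (int (lam q) - int (lam (Suc q))) - deficit q"
    if "p < q" "lam (Suc q) < lam q" for q
  proof -
    define x where "x = int (lam q) - int (lam (Suc q))"
    have "int (Suc n) * x = int n * x + x" by (simp add: algebra_simps)
    then show ?thesis using bd[OF that] unfolding x_def[symmetric] by linarith
  qed
  show ?thesis
    unfolding lr_arrays_def lr_row_def mem_Collect_eq
  proof (intro conjI allI impI)
    fix i k
    show "0 \<le> m (Suc i) k - block (Suc i) k"
    proof (cases "1 \<le> k \<and> Suc i = p + k \<and> 0 < lam (Suc i)")
      case True
      define d where "d = k - 1"
      have k: "k = Suc d" "Suc i = Suc (p + d)" using True by (auto simp: d_def)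
      have "top_ones + int (mu' (Suc p)) \<le> int n * int (lam (Suc i)) + int (lam' (Suc i))"
        by (rule block_entry_large[OF bd]) (use True in auto)
      moreover have "outer (Suc n) (Suc i) = int n * int (lam (Suc i)) + int (lam' (Suc i)) + int (lam (Suc i))"
        by (simp add: stretched_def algebra_simps)
      moreover have "block (Suc i) k = int (lam (Suc i))" using True by (simp add: block_def)
      ultimately show ?thesis
        using block_entry_ge[OF m, of d] top_ones_ge_diag[OF m, of d] unfolding k by linarith
    next
      case False
      then have "block (Suc i) k = 0" by (auto simp: block_def)
      then show ?thesis using lr_nonneg[OF m] by simp
    qed
    show "rowend (inner n) (\<lambda>i k. m i k - block i k) (Suc i) (Suc i) = outer n (Suc i)"
      unfolding re using lr_rowend_full[OF m, of "Suc i" "Suc i"] lr_rowend_full[OF block_lr, of "Suc i" "Suc i"]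
      by (simp add: stretched_Suc del: rowend.simps)
    show "colcount (\<lambda>i k. m i k - block i k) (Suc i) (Suc (Suc k)) \<le> colcount (\<lambda>i k. m i k - block i k) i (Suc k)"
    proof (cases "Suc (p + k) \<le> i \<and> lam (Suc (Suc (p + k))) < lam (Suc (p + k))")
      case True
      then show ?thesis using block_lattice_slack[OF m, of k i] slack[of "Suc (p + k)"]
        unfolding colcount_diff colcount_block by auto
    next
      case False
      then have "colcount block (Suc i) (Suc (Suc k)) = colcount block i (Suc k)"
        unfolding colcount_block using lam_mono[of "Suc (p + k)" "Suc (Suc (p + k))"] by auto
      then show ?thesis using lr_lattice[OF m, of i k] unfolding colcount_diff by linarith
    qed
    show "rowend (inner n) (\<lambda>i k. m i k - block i k) (Suc i) (Suc k) \<le> rowend (inner n) (\<lambda>i k. m i k - block i k) i k"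
      if i: "0 < i"
    proof (cases "p < i \<and> i \<le> p + k \<and> lam (Suc i) < lam i")
      case True
      define d where "d = i - Suc p"
      have d: "i = Suc (p + d)" "Suc d \<le> k" using True by (auto simp: d_def)
      show ?thesis using block_column_slack[OF m d(2)] slack[of i] True bot[of i] bot[of "Suc i"]
        unfolding re rowend_block d(1)[symmetric] by auto
    next
      case False
      then have "rowend (\<lambda>i. int (mu i)) block (Suc i) (Suc k) = rowend (\<lambda>i. int (mu i)) block i k"
        unfolding rowend_block using lam_mono[of i "Suc i"] i top[of i] top[of "Suc i"] bot[of i] bot[of "Suc i"]
        by (cases i p rule: linorder_cases) auto
      then show ?thesis using lr_column[OF m i, of k] unfolding re by linarith
    qed
  qed (rule tri)
qed

lemma Q_stable_if:
  assumes bd: "\<And>i. p < i \<Longrightarrow> lam (Suc i) < lam i \<Longrightarrow> deficit i \<le> int n * (int (lam i) - int (lam (Suc i)))"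
  shows "stable_from (Q_sum lam mu lam' mu') n"
proof -
  have "\<not> Q_sum lam mu lam' mu' n < Q_sum lam mu lam' mu' (Suc n)"
    unfolding Q_less_iff[OF block_lr] using arrays_diff_block[OF bd] by blast
  then have "Q_sum lam mu lam' mu' n = Q_sum lam mu lam' mu' (Suc n)" using Q_mono[of n] by simp
  then show ?thesis
    using growth_sequence_stable[of "Q_sum lam mu lam' mu'" n] Q_mono Q_growth_propagates by blast
qed

lemma outer_antimono: "1 \<le> i \<Longrightarrow> i \<le> j \<Longrightarrow> outer n j \<le> outer n i"
  using is_partition_mono[OF stretched_partition(1)] unfolding stretched_eq by simp

lemma inner_antimono: "1 \<le> i \<Longrightarrow> i \<le> j \<Longrightarrow> inner n j \<le> inner n i"
  using is_partition_mono[OF stretched_partition(2)] unfolding stretched_eq by simp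

section \<open>Sharpness: an array with the least possible slack\<close>

text \<open>
  The extremal filling: superstandard in the first \<open>p\<close> rows; every row down to \<open>s = p + 1 + e\<close> continues
  with as many large entries on the right as the lattice condition permits and with a superstandard left
  part; below row \<open>s\<close> it is superstandard with all entries raised by \<open>e + 1\<close>.
\<close>

lemma extremal_array:
  fixes e n :: nat
  defines "s \<equiv> Suc (p + e)"
  assumes basic: "\<And>i. 1 \<le> i \<Longrightarrow> mu' i \<le> lam' (Suc i)"
    and drop: "lam (Suc s) < lam s"
    and large: "top_ones + int (mu' (Suc p)) \<le> int n"
  obtains m where "m \<in> arrays n"
    "\<And>r. colcount m (s + r) (Suc e) = outer n s - int (mu' (Suc p))"
    "\<And>r. colcount m (Suc (s + r)) (Suc (Suc e)) = top_ones + outer n (Suc s) - inner n (Suc (s + r))"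
proof -
  let ?a = "outer n" and ?b = "inner n"
  obtain m0 where m0: "m0 \<in> arrays n"
    and ones0: "\<And>i. (\<And>r. 1 \<le> r \<Longrightarrow> r < i \<Longrightarrow> ?b r \<le> ?a (Suc r)) \<Longrightarrow> 0 < i \<Longrightarrow> colcount m0 i 1 = ?a 1 - ?b i"
    using lr_superstandard[OF skew_shape_stretched[of n]] by blast
  \<comment> \<open>The content of the first \<open>p\<close> rows. Each middle row lifts all of it
    by one value: after row \<open>Suc (p + d)\<close>, the value \<open>Suc d + l\<close> with
    \<open>l \<ge> 1\<close> occurs \<open>\<kappa> l\<close> times.\<close>
  define \<kappa> where "\<kappa> l = colcount m0 p l" for l
  have \<kappa>1: "\<kappa> (Suc 0) = top_ones"
  proof (cases "p = 0")
    case True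
    then show ?thesis unfolding \<kappa>_def top_ones_def by simp
  next
    case False
    \<comment> \<open>Basicness excludes truncation in the first \<open>p\<close> rows, so
      \<open>m0\<close> attains the bound \<open>top_ones\<close> on the entries 1.\<close>
    have "?b r \<le> ?a (Suc r)" if "1 \<le> r" "r < p" for r
      using top[of r] top[of "Suc r"] basic[of r] that by (simp add: stretched_def)
    then have "colcount m0 p 1 = ?a 1 - ?b p" using ones0[of p] False by blast
    then show ?thesis using outer_top[of n] False by (simp add: \<kappa>_def)
  qed
  have \<kappa>0: "\<kappa> l = 0" if "p < l" for l
    using lower_tri_colcount_zero[of m0 p l] m0 that by (auto simp: \<kappa>_def lr_arrays_def)
  have \<kappa>nn: "0 \<le> \<kappa> l" for l unfolding \<kappa>_def by (rule lr_colcount_nonneg[OF m0])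
  have \<kappa>dec: "\<kappa> (Suc (Suc l)) \<le> \<kappa> (Suc l)" for l
    unfolding \<kappa>_def by (rule lr_colcount_partition[OF m0])
  have \<kappa>le: "\<kappa> (Suc l) \<le> top_ones" for l
    by (induction l) (use \<kappa>1 \<kappa>dec in \<open>auto intro: order_trans\<close>)
  have "skew_shape (\<lambda>i. ?a (s + i)) (\<lambda>i. ?b (s + i))"
    using skew_shape_stretched[of n] by (simp add: skew_shape_def)
  then obtain m1 where m1: "m1 \<in> lr_arrays (\<lambda>i. ?a (s + i)) (\<lambda>i. ?b (s + i))"
    and ones1': "\<And>i. (\<And>r. 1 \<le> r \<Longrightarrow> r < i \<Longrightarrow> ?b (s + r) \<le> ?a (s + Suc r)) \<Longrightarrow> 0 < i \<Longrightarrow> colcount m1 i 1 = ?a (s + 1) - ?b (s + i)"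
    using lr_superstandard by blast
  have ones1: "colcount m1 (Suc r) (Suc 0) = ?a (Suc s) - ?b (Suc (s + r))" for r
  proof -
    have "?b (s + i) \<le> ?a (s + Suc i)" if "1 \<le> i" for i
    proof -
      have "mu (s + i) = 0" by (rule bot) (simp add: s_def)
      then show ?thesis using basic[of "s + i"] that by (simp add: stretched_def add_increasing)
    qed
    then show ?thesis using ones1'[of "Suc r"] by simp
  qed
  \<comment> \<open>In row \<open>Suc (p + d)\<close> the entries up to \<open>d\<close> end in
    column \<open>inner n (Suc p)\<close> and the entries above \<open>Suc d\<close> take the last
    \<open>\<kappa> 1 = top_ones\<close> boxes; \<open>Suc d\<close> fills the space
    between.\<close>
  define m where "m i k =
    (if i \<le> p then m0 i k
     else if i \<le> s then
       (case k of 0 \<Rightarrow> 0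
        | Suc l \<Rightarrow> if l < i - Suc p then ?b (i - Suc l) - ?b (i - l)
            else if l = i - Suc p then ?a i - top_ones - ?b (Suc p)
            else \<kappa> (l - (i - Suc p)) - \<kappa> (Suc l - (i - Suc p)))
     else if k \<le> Suc e then 0 else m1 (i - s) (k - Suc e))" for i k
  have m_top: "m i = m0 i" if "i \<le> p" for i using that by (simp add: m_def fun_eq_iff)
  have m_mid0: "m (Suc (p + d)) 0 = 0" if "d \<le> e" for d using that by (simp add: m_def s_def)
  have m_mid: "m (Suc (p + d)) (Suc l) =
      (if l < d then ?b (p + d - l) - ?b (Suc (p + d) - l)
       else if l = d then ?a (Suc (p + d)) - top_ones - ?b (Suc p)
       else \<kappa> (l - d) - \<kappa> (Suc l - d))" if "d \<le> e" for d l
    using that by (simp add: m_def s_def)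
  have m_bot: "m (s + Suc r) k = (if k \<le> Suc e then 0 else m1 (Suc r) (k - Suc e))" for r k
    by (simp add: m_def s_def)

  have cc_top: "colcount m i k = colcount m0 i k" if "i \<le> p" for i k
    by (rule colcount_cong) (use m_top that in simp)
  have cc_mid: "colcount m (Suc (p + d)) (Suc l) = (if l \<le> d then ?a (Suc (p + l)) - ?b (Suc (p + d) - l) else \<kappa> (l - d))"
    if "d \<le> e" for d l
    using that
  proof (induction d)
    case 0
    have "colcount m p (Suc l) = \<kappa> (Suc l)" using cc_top by (simp add: \<kappa>_def)
    then show ?case using m_mid[of 0 l] \<kappa>1 by auto
  next
    case (Suc d)
    have c: "colcount m (Suc (p + d)) (Suc l) = (if l \<le> d then ?a (Suc (p + l)) - ?b (Suc (p + d) - l) else \<kappa> (l - d))"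
      using Suc by simp
    have step: "colcount m (Suc (p + Suc d)) (Suc l) = colcount m (Suc (p + d)) (Suc l) + m (Suc (p + Suc d)) (Suc l)"
      by simp
    show ?case
    proof (cases l "Suc d" rule: linorder_cases)
      case less
      then show ?thesis unfolding step c using m_mid[OF Suc.prems, of l] by simp
    next
      case equal
      then show ?thesis unfolding step c using m_mid[OF Suc.prems, of l] \<kappa>1 by simp
    next
      case greater
      then have "Suc l - Suc d = l - d" "\<not> l \<le> d" "\<not> l < Suc d" by auto
      then show ?thesis unfolding step c using m_mid[OF Suc.prems, of l] greater by simp
    qed
  qed
  have cc_s: "colcount m s (Suc l) = (if l \<le> e then ?a (Suc (p + l)) - ?b (s - l) else \<kappa> (l - e))" for l
    using cc_mid[of e l] by (simp add: s_def)
  have cc_bot: "colcount m (s + r) k = colcount m s k + (if k \<le> Suc e then 0 else colcount m1 r (k - Suc e))" for r k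
  proof (induction r)
    case (Suc r)
    then show ?case using m_bot[of r k] by simp
  qed simp
  have re_top: "rowend ?b m i k = rowend ?b m0 i k" if "i \<le> p" for i k
    by (rule rowend_cong) (use m_top that in simp)
  have re_mid: "rowend ?b m (Suc (p + d)) k = (if k \<le> d then ?b (Suc (p + d) - k) else ?a (Suc (p + d)) - \<kappa> (k - d))"
    if "d \<le> e" for d k
  proof (induction k)
    case (Suc k)
    have step: "rowend ?b m (Suc (p + d)) (Suc k) = rowend ?b m (Suc (p + d)) k + m (Suc (p + d)) (Suc k)"
      by simp
    show ?case
    proof (cases k d rule: linorder_cases)
      case less
      then show ?thesis unfolding step Suc using m_mid[OF that, of k] by simp
    next
      case equal
      then show ?thesis unfolding step Suc using m_mid[OF that, of k] \<kappa>1 by simp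
    next
      case greater
      then show ?thesis unfolding step Suc using m_mid[OF that, of k] by simp
    qed
  qed simp
  have re_bot: "rowend ?b m (s + Suc r) k =
      (if k \<le> Suc e then ?b (s + Suc r) else rowend (\<lambda>i. ?b (s + i)) m1 (Suc r) (k - Suc e))" for r k
  proof (induction k)
    case (Suc k)
    have step: "rowend ?b m (s + Suc r) (Suc k) = rowend ?b m (s + Suc r) k + m (s + Suc r) (Suc k)" by simp
    show ?case
    proof (cases "Suc e \<le> k")
      case True
      define q where "q = k - Suc e"
      have q: "k = Suc e + q" using True by (simp add: q_def)
      show ?thesis unfolding step Suc m_bot unfolding q by (cases q) simp_all
    next
      case False
      then show ?thesis unfolding step Suc using m_bot[of r "Suc k"] by simp
    qed
  qed simp

  have lam_s: "1 \<le> lam s" using drop by simp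
  \<comment> \<open>Here \<open>n\<close> has to be large: a drop of at least 1, taken
    \<open>n\<close> times, makes room for the entries \<open>Suc (Suc e)\<close> already present
    and those of row \<open>Suc s\<close>.\<close>
  have large_drop: "?a (Suc s) + top_ones + int (mu' (Suc p)) \<le> ?a s"
  proof -
    have "int n * 1 \<le> int n * (int (lam s) - int (lam (Suc s)))" using drop by (intro mult_left_mono) auto
    moreover have "lam' (Suc s) \<le> lam' s" using is_partition_mono[OF lam', of s "Suc s"] by (simp add: s_def)
    ultimately show ?thesis using large by (simp add: stretched_def algebra_simps)
  qed
  have large_mid: "top_ones + ?b (Suc p) \<le> ?a (Suc (p + d))" if "d \<le> e" for d
  proof -
    have "1 \<le> lam (Suc (p + d))" using lam_mono[of "Suc (p + d)" s] lam_s that by (simp add: s_def)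
    then have "int n * 1 \<le> int n * int (lam (Suc (p + d)))" by (intro mult_left_mono) auto
    then show ?thesis using large bot[of "Suc p"] by (simp add: stretched_def)
  qed
  have bp: "?b (Suc p) = int (mu' (Suc p))" by (rule inner_below) simp

  have "lower_tri m"
    unfolding lower_tri_def
  proof (intro allI impI)
    fix i k :: nat assume ik: "k = 0 \<or> i < k"
    consider "i \<le> p" | d where "d \<le> e" "i = Suc (p + d)" | r where "i = s + Suc r"
    proof (cases "i \<le> p")
      case False
      show ?thesis
      proof (cases "i \<le> s")
        case True
        then show ?thesis using that(2)[of "i - Suc p"] False by (simp add: s_def)
      next
        case False
        then show ?thesis using that(3)[of "i - Suc s"] by simp
      qed
    qed (use that in blast)
    then show "m i k = 0"
    proof cases
      case 1
      then show ?thesis using m_top lr_tri[OF m0, of k i] ik by simp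
    next
      case (2 d)
      show ?thesis
      proof (cases k)
        case 0
        then show ?thesis using m_mid0 2 by simp
      next
        case (Suc l)
        then have l: "Suc (p + d) \<le> l" using ik 2 by simp
        then have "\<kappa> (l - d) = 0" "\<kappa> (Suc l - d) = 0" by (auto intro: \<kappa>0)
        then show ?thesis using m_mid[OF 2(1), of l] l by (simp add: Suc 2(2))
      qed
    next
      case (3 r)
      then show ?thesis using m_bot[of r k] lr_tri[OF m1, of "k - Suc e" "Suc r"] ik
        by (auto simp: s_def)
    qed
  qed
  moreover have "lr_row ?a ?b m i" for i
  proof -
    consider "Suc i \<le> p" | d where "d \<le> e" "i = p + d" | r where "i = s + r"
    proof (cases "Suc i \<le> p")
      case False
      show ?thesis
      proof (cases "Suc i \<le> s")
        case True
        then show ?thesis using that(2)[of "i - p"] False by (simp add: s_def)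
      next
        case False
        then show ?thesis using that(3)[of "i - s"] by simp
      qed
    qed (use that in blast)
    then show ?thesis
    proof cases
      case 1
      then have "lr_row ?a ?b m i = lr_row ?a ?b m0 i" by (intro lr_row_cong m_top) simp
      then show ?thesis using m0 by (simp add: lr_arrays_def)
    next
      case (2 d)
      show ?thesis
        unfolding lr_row_def 2(2)
      proof (intro conjI allI impI)
        fix k
        show "0 \<le> m (Suc (p + d)) k"
        proof (cases k)
          case (Suc l)
          have "?b (Suc (p + d) - l) \<le> ?b (p + d - l)" if "l < d"
            using that by (intro inner_antimono) auto
          moreover have "\<kappa> (Suc l - d) \<le> \<kappa> (l - d)" if "d < l"
          proof -
            define c where "c = l - Suc d"
            have "l - d = Suc c" "Suc l - d = Suc (Suc c)" using that by (auto simp: c_def)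
            then show ?thesis using \<kappa>dec[of c] by simp
          qed
          ultimately show ?thesis unfolding Suc m_mid[OF 2(1)] using large_mid[OF 2(1)] by auto
        qed (use m_mid0 2 in simp)
        show "rowend ?b m (Suc (p + d)) (Suc (p + d)) = ?a (Suc (p + d))"
          unfolding re_mid[OF 2(1)] using \<kappa>0[of "Suc (p + d) - d"] by simp
        show "colcount m (Suc (p + d)) (Suc (Suc k)) \<le> colcount m (p + d) (Suc k)"
        proof (cases d)
          case 0
          then show ?thesis using cc_mid[OF 2(1), of "Suc k"] cc_top[of p "Suc k"] by (simp add: \<kappa>_def del: colcount.simps)
        next
          case (Suc d')
          have d': "d' \<le> e" using Suc 2(1) by simp
          have "colcount m (p + d) (Suc k) = (if k \<le> d' then ?a (Suc (p + k)) - ?b (Suc (p + d') - k) else \<kappa> (k - d'))"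
            using cc_mid[OF d', of k] Suc by (simp del: colcount.simps)
          then show ?thesis unfolding cc_mid[OF 2(1)] using Suc outer_antimono[of "Suc (p + k)" "Suc (p + Suc k)" n] by simp
        qed
        show "rowend ?b m (Suc (p + d)) (Suc k) \<le> rowend ?b m (p + d) k" if pd: "0 < p + d"
        proof (cases d)
          case 0
          then obtain q where q: "p = Suc q" using pd by (cases p) auto
          \<comment> \<open>Row \<open>Suc p\<close> has \<open>\<kappa> (Suc k)\<close> entries
            above \<open>Suc k\<close>, and row \<open>p\<close> has at most that many above
            \<open>k\<close>; together with the row lengths this is the column condition at the
            seam.\<close>
          have "?a p - rowend ?b m0 p k \<le> \<kappa> (Suc k)"
            using lr_tail_row[OF m0, of q k] by (simp add: q \<kappa>_def del: colcount.simps)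
          moreover have "?a (Suc p) \<le> ?a p" by (rule outer_antimono) (use q in auto)
          ultimately show ?thesis using re_mid[OF 2(1), of "Suc k"] re_top[of p k] 0 by (simp del: rowend.simps)
        next
          case (Suc d')
          have d': "d' \<le> e" using Suc 2(1) by simp
          have "rowend ?b m (p + d) k = (if k \<le> d' then ?b (Suc (p + d') - k) else ?a (Suc (p + d')) - \<kappa> (k - d'))"
            using re_mid[OF d', of k] Suc by (simp del: rowend.simps)
          then show ?thesis unfolding re_mid[OF 2(1)] using Suc outer_antimono[of "Suc (p + d')" "Suc (p + d)" n] by simp
        qed
      qed
    next
      case (3 r)
      have Sr: "Suc (s + r) = s + Suc r" by simp
      show ?thesis
        unfolding lr_row_def 3 Sr
      proof (intro conjI allI impI)
        fix k
        show "0 \<le> m (s + Suc r) k" unfolding m_bot using lr_nonneg[OF m1] by simp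
        show "rowend ?b m (s + Suc r) (s + Suc r) = ?a (s + Suc r)"
          unfolding re_bot using lr_rowend_full[OF m1, of "Suc r" "s + Suc r - Suc e"] by (simp add: s_def del: rowend.simps)
        show "colcount m (s + Suc r) (Suc (Suc k)) \<le> colcount m (s + r) (Suc k)"
        proof (cases k e rule: linorder_cases)
          case less
          then have "?b (s - k) \<le> ?b (s - Suc k)" by (intro inner_antimono) (auto simp: s_def)
          then show ?thesis unfolding cc_bot cc_s using less outer_antimono[of "Suc (p + k)" "Suc (p + Suc k)" n] by simp
        next
          case equal
          then show ?thesis unfolding cc_bot cc_s using ones1[of r] \<kappa>1 large_drop inner_nonneg[of n "Suc (s + r)"] bp
            by (simp add: s_def del: colcount.simps)
        next
          case greater
          define q where "q = k - Suc e"
          have q: "k = Suc (e + q)" using greater by (simp add: q_def)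
          show ?thesis unfolding cc_bot cc_s using lr_lattice[OF m1, of r q] \<kappa>dec[of q] by (simp add: q del: colcount.simps)
        qed
        show "rowend ?b m (s + Suc r) (Suc k) \<le> rowend ?b m (s + r) k"
        proof (cases r)
          case 0
          have ms: "rowend ?b m s k = (if k \<le> e then ?b (s - k) else ?a s - \<kappa> (k - e))"
            using re_mid[of e k] by (simp add: s_def del: rowend.simps)
          show ?thesis
          proof (cases "k \<le> e")
            case True
            then have "?b (Suc s) \<le> ?b (s - k)" by (intro inner_antimono) (auto simp: s_def)
            then show ?thesis unfolding re_bot using True 0 ms by (simp del: rowend.simps)
          next
            case False
            define q where "q = k - Suc e"
            have q: "k = Suc (e + q)" using False by (simp add: q_def)
            have "rowend (\<lambda>i. ?b (s + i)) m1 (Suc 0) (Suc k - Suc e) \<le> ?a (Suc s)"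
              using lr_rowend_le[OF m1, of "Suc 0" "Suc k - Suc e"] by (simp del: rowend.simps)
            also have "\<dots> \<le> ?a s - \<kappa> (k - e)" using large_drop \<kappa>le[of q] by (simp add: q)
            finally show ?thesis unfolding re_bot using False 0 ms by (simp del: rowend.simps)
          qed
        next
          case (Suc r')
          show ?thesis
          proof (cases "k \<le> e")
            case True
            then show ?thesis unfolding re_bot Suc using inner_antimono[of "s + Suc r'" "s + Suc (Suc r')" n]
              by (simp add: s_def del: rowend.simps)
          next
            case False
            define q where "q = k - Suc e"
            have q: "k = Suc e + q" using False by (simp add: q_def)
            have "rowend (\<lambda>i. ?b (s + i)) m1 (Suc (Suc r')) (Suc q) \<le> rowend (\<lambda>i. ?b (s + i)) m1 (Suc r') q"
              by (rule lr_column[OF m1]) simp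
            then show ?thesis unfolding re_bot Suc by (cases q) (simp_all add: q del: rowend.simps, simp)
          qed
        qed
      qed
    qed
  qed
  ultimately have "m \<in> arrays n" unfolding lr_arrays_def by blast
  moreover have "colcount m (s + r) (Suc e) = ?a s - int (mu' (Suc p))" for r
    unfolding cc_bot cc_s using bp by (simp add: s_def)
  moreover have "colcount m (Suc (s + r)) (Suc (Suc e)) = top_ones + ?a (Suc s) - ?b (Suc (s + r))" for r
    using cc_bot[of "Suc r" "Suc (Suc e)"] cc_s[of "Suc e"] ones1[of r] \<kappa>1 by (simp del: colcount.simps)
  ultimately show ?thesis using that by blast
qed

text \<open>Stability from \<open>n\<close> on would let every array of a later stage descend to
  stage \<open>n\<close> by subtraction of copies of \<open>block\<close>. The extremal array would
  arrive there with negative lattice slack.\<close>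

lemma Q_not_stable_if:
  assumes basic: "\<And>i. 1 \<le> i \<Longrightarrow> mu' i \<le> lam' (Suc i)"
    and i: "p < i" "lam (Suc i) < lam i"
    and small: "int n * (int (lam i) - int (lam (Suc i))) < deficit i"
  shows "\<not> stable_from (Q_sum lam mu lam' mu') n"
proof
  assume st: "stable_from (Q_sum lam mu lam' mu') n"
  define e where "e = i - Suc p"
  have ie: "i = Suc (p + e)" using i by (simp add: e_def)
  \<comment> \<open>Makes stage \<open>n + D\<close> large enough for the extremal array.\<close>
  define D where "D = nat (top_ones + int (mu' (Suc p)))"
  obtain m where m: "m \<in> arrays (n + D)"
    and c1: "\<And>r. colcount m (i + r) (Suc e) = outer (n + D) i - int (mu' (Suc p))"
    and c2: "\<And>r. colcount m (Suc (i + r)) (Suc (Suc e)) = top_ones + outer (n + D) (Suc i) - inner (n + D) (Suc (i + r))"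
  proof (rule extremal_array[of e "n + D"])
    show "mu' i \<le> lam' (Suc i)" if "1 \<le> i" for i using basic that .
    show "lam (Suc (Suc (p + e))) < lam (Suc (p + e))" using i(2) ie by simp
    show "top_ones + int (mu' (Suc p)) \<le> int (n + D)" by (simp add: D_def)
  qed (use that ie in blast)
  have desc: "(\<lambda>i k. x i k - int d * block i k) \<in> arrays n" if "x \<in> arrays (n + d)" for x d
    using that
  proof (induction d arbitrary: x)
    case (Suc d)
    have "\<not> Q_sum lam mu lam' mu' (n + d) < Q_sum lam mu lam' mu' (Suc (n + d))"
      using st unfolding stable_from_def by (metis le_add1 less_irrefl add_Suc_right)
    then have "(\<lambda>i k. x i k - block i k) \<in> arrays (n + d)"
      using Suc.prems unfolding Q_less_iff[OF block_lr] by auto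
    from Suc.IH[OF this] show ?case by (simp add: algebra_simps)
  qed simp
  \<comment> \<open>So far down the inner shape is 0 and the count of \<open>Suc (Suc e)\<close> is
    as large as possible; after the descent the slack is \<open>n\<close> times the drop minus
    \<open>deficit i\<close>.\<close>
  define r where "r = part_length mu'"
  have "mu' (Suc (i + r)) = 0" by (rule is_partition_zero_beyond_length[OF mu']) (simp add: r_def)
  then have b0: "inner (n + D) (Suc (i + r)) = 0" using inner_below[of "Suc (i + r)" "n + D"] i by simp
  have cb: "colcount (\<lambda>i k. int D * block i k) q k = int D * colcount block q k" for q k
    by (induction q) (auto simp: algebra_simps)
  have "colcount (\<lambda>i k. m i k - int D * block i k) (Suc (i + r)) (Suc (Suc e))
      \<le> colcount (\<lambda>i k. m i k - int D * block i k) (i + r) (Suc e)"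
    by (rule lr_lattice[OF desc[OF m]])
  then have "top_ones + outer (n + D) (Suc i) - int D * int (lam (Suc i))
      \<le> outer (n + D) i - int (mu' (Suc p)) - int D * int (lam i)"
    unfolding colcount_diff cb c1 c2 b0 colcount_block by (simp add: ie)
  then show False using small by (simp add: stretched_def deficit_def algebra_simps)
qed

end

text \<open>The second identity includes \<open>j = k + 1\<close>, where both sides are 0, so that
  the drop after the last part is covered.\<close>

lemma partition_of_list_block:
  fixes \<alpha> :: "nat \<Rightarrow> nat" and p :: nat
  assumes "1 \<le> k" "\<alpha> (k + 1) = 0"
  defines "lam \<equiv> partition_of_list (replicate (Suc p) (\<alpha> 1) @ map \<alpha> [2..<k + 1])"
  shows "1 \<le> i \<Longrightarrow> i \<le> Suc p \<Longrightarrow> lam i = \<alpha> 1"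
    and "1 \<le> j \<Longrightarrow> j \<le> k + 1 \<Longrightarrow> lam (p + j) = \<alpha> j"
    and "k < j \<Longrightarrow> lam (p + j) = 0"
proof -
  show top: "lam i = \<alpha> 1" if "1 \<le> i" "i \<le> Suc p" for i
    using that by (auto simp: lam_def partition_of_list_def nth_append simp del: replicate_Suc)
  show bot: "lam (p + j) = 0" if "k < j" for j
    using that assms(1) by (auto simp: lam_def partition_of_list_def simp del: upt_Suc replicate_Suc)
  show "lam (p + j) = \<alpha> j" if j: "1 \<le> j" "j \<le> k + 1"
  proof -
    consider "j = 1" | "j = k + 1" | "2 \<le> j" "j \<le> k" using j by linarith
    then show ?thesis
    proof cases
      case 1
      then show ?thesis using top[of "Suc p"] by simp
    next
      case 2
      then show ?thesis using bot[of j] assms(2) by simp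
    next
      case 3
      then have "\<not> p + j - 1 < Suc p" "p + j - 1 - Suc p = j - 2" "j - 2 < length [2..<k + 1]" "2 + (j - 2) = j" by auto
      moreover from this have "map \<alpha> [2..<k + 1] ! (p + j - 1 - Suc p) = \<alpha> j" by (simp del: upt_Suc)
      ultimately show ?thesis using 3
        by (simp add: lam_def partition_of_list_def nth_append del: replicate_Suc upt_Suc)
    qed
  qed
qed

text \<open>A natural number \<open>n\<close> is at least the rounded maximum if and only if it
  satisfies every inequality between a \<open>deficit\<close> and \<open>n\<close> times a drop.
  This removes the division, the ceiling and the truncation at 0, and the two criteria for stability
  apply directly.\<close>

lemma (in stretch) Q_stable_bound:
  assumes basic: "basic_skew lam' mu'" and k: "1 \<le> k" "\<alpha> k \<noteq> 0" "\<alpha> (k + 1) = 0"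
    and lam_eq: "lam = partition_of_list (replicate (Suc p) (\<alpha> 1) @ map \<alpha> [2..<k + 1])"
    and mu_eq: "mu = partition_of_list (replicate p (\<alpha> 1))"
  shows "least_stable (Q_sum lam mu lam' mu') (stable_bound lam' mu' (Suc p) k \<alpha>)"
proof -
  note lam_block = partition_of_list_block[where p = p and \<alpha> = \<alpha>, OF k(1,3), folded lam_eq]
  interpret stretch_block lam mu lam' mu' p
  proof unfold_locales
    fix i
    show "lam i = lam (Suc p) \<and> mu i = lam (Suc p)" if "1 \<le> i" "i \<le> p"
      using that lam_block(1)[of i] lam_block(1)[of "Suc p"] by (simp add: mu_eq partition_of_list_def)
    show "mu i = 0" if "p < i" using that by (simp add: mu_eq partition_of_list_def)
  qed
  have basic': "mu' i \<le> lam' (Suc i)" if i: "1 \<le> i" for i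
  proof (cases "i \<le> part_length lam'")
    case True
    then show ?thesis using basic i by (simp add: basic_skew_def)
  next
    case False
    then have "lam' i = 0" using is_partition_zero_beyond_length[OF lam', of i] by simp
    moreover have "mu' i \<le> lam' i" using sub' by (simp add: part_contained_def)
    ultimately show ?thesis by simp
  qed
  define J where "J = {j. 1 \<le> j \<and> j \<le> k \<and> \<alpha> (j + 1) < \<alpha> j}"
  define f where "f j = (real (lam' 1) - real (lam' (p + j)) + real (lam' (p + j + 1)) + real (mu' (Suc p))
     - real (if Suc p = 1 then lam' 1 else mu' p)) / (real (\<alpha> j) - real (\<alpha> (j + 1)))" for j
  \<comment> \<open>The convention for the missing part of \<open>mu'\<close> agrees with
    \<open>top_ones = 0\<close> when \<open>p = 0\<close>.\<close>
  have f_eq: "f j = real_of_int (deficit (p + j)) / (real (\<alpha> j) - real (\<alpha> (j + 1)))" for j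
    unfolding f_def deficit_def top_ones_def by auto
  have bound: "stable_bound lam' mu' (Suc p) k \<alpha> = nat \<lceil>Max (f ` J)\<rceil>"
  proof -
    have "f ` J = {(real (lam' 1) - real (lam' (p + j)) + real (lam' (p + j + 1)) + real (mu' (Suc p))
     - real (if Suc p = 1 then lam' 1 else mu' p)) / (real (\<alpha> j) - real (\<alpha> (j + 1))) | j. 1 \<le> j \<and> j \<le> k \<and> \<alpha> (j + 1) < \<alpha> j}"
      by (auto simp: J_def f_def)
    then show ?thesis unfolding stable_bound_def Let_def by simp
  qed
  have J: "finite J" "J \<noteq> {}"
  proof -
    show "finite J" by (rule finite_subset[of _ "{..k}"]) (auto simp: J_def)
    have "k \<in> J" using k by (simp add: J_def)
    then show "J \<noteq> {}" by blast
  qed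
  have bound_le: "stable_bound lam' mu' (Suc p) k \<alpha> \<le> n \<longleftrightarrow>
      (\<forall>j\<in>J. deficit (p + j) \<le> int n * (int (\<alpha> j) - int (\<alpha> (j + 1))))" for n
  proof -
    have "stable_bound lam' mu' (Suc p) k \<alpha> \<le> n \<longleftrightarrow> Max (f ` J) \<le> real n"
      unfolding bound nat_le_iff ceiling_le_iff by simp
    also have "\<dots> \<longleftrightarrow> (\<forall>j\<in>J. f j \<le> real n)" using J by (simp add: Max_le_iff)
    also have "\<dots> \<longleftrightarrow> (\<forall>j\<in>J. deficit (p + j) \<le> int n * (int (\<alpha> j) - int (\<alpha> (j + 1))))"
    proof (rule ball_cong[OF refl])
      fix j assume "j \<in> J"
      then have "0 < real (\<alpha> j) - real (\<alpha> (j + 1))" by (simp add: J_def)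
      then have "f j \<le> real n \<longleftrightarrow> real_of_int (deficit (p + j)) \<le> real n * (real (\<alpha> j) - real (\<alpha> (j + 1)))"
        unfolding f_eq by (rule pos_divide_le_eq)
      also have "real n * (real (\<alpha> j) - real (\<alpha> (j + 1))) = real_of_int (int n * (int (\<alpha> j) - int (\<alpha> (j + 1))))"
        by simp
      finally show "f j \<le> real n \<longleftrightarrow> deficit (p + j) \<le> int n * (int (\<alpha> j) - int (\<alpha> (j + 1)))"
        by (simp only: of_int_le_iff)
    qed
    finally show ?thesis .
  qed
  show ?thesis unfolding least_stable_def
  proof (intro conjI allI impI)
    show "stable_from (Q_sum lam mu lam' mu') (stable_bound lam' mu' (Suc p) k \<alpha>)" (is "stable_from _ ?n")
    proof (rule Q_stable_if)
      fix i assume i: "p < i" "lam (Suc i) < lam i"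
      define j where "j = i - p"
      have j: "i = p + j" "1 \<le> j" using i by (auto simp: j_def)
      have "j \<le> k" using lam_block(3)[of j] i j by (cases "j \<le> k") auto
      then have l: "lam i = \<alpha> j" "lam (Suc i) = \<alpha> (j + 1)"
        using lam_block(2)[of j] lam_block(2)[of "j + 1"] j by auto
      have "j \<in> J" using \<open>j \<le> k\<close> j i l by (simp add: J_def)
      moreover have "\<forall>j\<in>J. deficit (p + j) \<le> int ?n * (int (\<alpha> j) - int (\<alpha> (j + 1)))"
        using bound_le[of ?n] by blast
      ultimately show "deficit i \<le> int ?n * (int (lam i) - int (lam (Suc i)))"
        using l j by auto
    qed
    fix n assume st: "stable_from (Q_sum lam mu lam' mu') n"
    show "stable_bound lam' mu' (Suc p) k \<alpha> \<le> n"
    proof (rule ccontr)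
      assume "\<not> ?thesis"
      then obtain j where j: "j \<in> J" "\<not> deficit (p + j) \<le> int n * (int (\<alpha> j) - int (\<alpha> (j + 1)))"
        using bound_le by blast
      then have "lam (p + j) = \<alpha> j" "lam (Suc (p + j)) = \<alpha> (j + 1)" "p < p + j"
        using lam_block(2)[of j] lam_block(2)[of "j + 1"] by (auto simp: J_def)
      then show False using Q_not_stable_if[OF basic', of "p + j" n] j st by (auto simp: J_def)
    qed
  qed
qed

theorem theorem4p2:
  fixes lam mu lam' mu' :: "nat \<Rightarrow> nat" and Q :: "nat \<Rightarrow> nat"
  defines "Q \<equiv> Q_sum lam mu lam' mu'"
  assumes "is_partition lam" and "is_partition mu" and "is_partition lam'" and "is_partition mu'"
    and "part_contained mu lam" and "part_contained mu' lam'"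
    and "diagram_is_partition (skew_diagram lam mu) \<or>
         diagram_is_rotated_partition (skew_diagram lam mu)"
  shows "(\<exists>m. \<forall>n\<ge>m. Q n = Q m) \<and>
    (\<forall>(a\<^sub>1::nat) (k::nat) (\<alpha>::nat \<Rightarrow> nat).
       1 \<le> a\<^sub>1 \<and> 1 \<le> k \<and> \<alpha> k \<noteq> 0 \<and> \<alpha> (k + 1) = 0 \<and>
       lam = partition_of_list (replicate a\<^sub>1 (\<alpha> 1) @ map \<alpha> [2..<k + 1]) \<and>
       mu = partition_of_list (replicate (a\<^sub>1 - 1) (\<alpha> 1)) \<and>
       basic_skew lam' mu' \<longrightarrow>
         least_stable Q (stable_bound lam' mu' a\<^sub>1 k \<alpha>) \<and>
         (\<forall>n < stable_bound lam' mu' a\<^sub>1 k \<alpha>. Q n < Q (n + 1))) \<and>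
    (\<forall>m. least_stable Q m \<longrightarrow> (\<forall>n<m. Q n < Q (n + 1)))"
proof -
  interpret stretch lam mu lam' mu' using assms(2-7) by unfold_locales
  have strict: "Q n < Q (n + 1)" if "least_stable Q m" "n < m" for m n
  proof (rule growth_sequence_strict[of Q])
    show "Q n \<le> Q (Suc n)" for n unfolding Q_def by (rule Q_mono)
    show "Q n < Q (Suc n)" if "Q (Suc n) < Q (Suc (Suc n))" for n
      using that unfolding Q_def by (rule Q_growth_propagates)
  qed (fact that)+
  have "(\<exists>c. \<forall>i. mu i < lam i \<longrightarrow> mu i = c) \<or> (\<exists>c. \<forall>i. mu i < lam i \<longrightarrow> lam i = c)"
    using assms(8) partition_diagram_inner_const rotated_diagram_outer_const by (rule disj_forward)
  from Q_bounded[OF this] obtain B where "\<forall>n. Q n \<le> B" unfolding Q_def ..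
  then have stable: "\<exists>m. \<forall>n\<ge>m. Q n = Q m"
    unfolding Q_def by (intro growth_sequence_bounded[where B = B] Q_mono) simp
  have least: "least_stable Q (stable_bound lam' mu' a\<^sub>1 k \<alpha>)"
    if "1 \<le> a\<^sub>1 \<and> 1 \<le> k \<and> \<alpha> k \<noteq> 0 \<and> \<alpha> (k + 1) = 0 \<and>
       lam = partition_of_list (replicate a\<^sub>1 (\<alpha> 1) @ map \<alpha> [2..<k + 1]) \<and>
       mu = partition_of_list (replicate (a\<^sub>1 - 1) (\<alpha> 1)) \<and> basic_skew lam' mu'" for a\<^sub>1 k :: nat and \<alpha>
  proof -
    obtain p where p: "a\<^sub>1 = Suc p" using \<open>1 \<le> a\<^sub>1 \<and> _\<close> by (cases a\<^sub>1) auto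
    show ?thesis unfolding Q_def p
      by (rule Q_stable_bound) (use that p in simp_all)
  qed
  show ?thesis
  proof (intro conjI allI impI)
    show "\<exists>m. \<forall>n\<ge>m. Q n = Q m" by (rule stable)
  next
    fix a\<^sub>1 k :: nat and \<alpha>
    assume A: "1 \<le> a\<^sub>1 \<and> 1 \<le> k \<and> \<alpha> k \<noteq> 0 \<and> \<alpha> (k + 1) = 0 \<and>
       lam = partition_of_list (replicate a\<^sub>1 (\<alpha> 1) @ map \<alpha> [2..<k + 1]) \<and>
       mu = partition_of_list (replicate (a\<^sub>1 - 1) (\<alpha> 1)) \<and> basic_skew lam' mu'"
    show "least_stable Q (stable_bound lam' mu' a\<^sub>1 k \<alpha>)" by (rule least[OF A])
    show "Q n < Q (n + 1)" if "n < stable_bound lam' mu' a\<^sub>1 k \<alpha>" for n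
      by (rule strict[OF least[OF A] that])
  qed (rule strict)
qed

end
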